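(* Let $n\ge 1$ and let $R,S$ be integers with $0<R,S<p^n$. Put $m=\min(R,S)$, $e=R+S-p^n$, and let $V_R\otimes V_S\cong V_{\mu_1}\oplus\dots\oplus V_{\mu_m}$ with $\mu_1\ge\dots\ge\mu_m>0$. Let $k$ be an integer with $\max(e,0)+1\le k\le m$, and let $k'=k_0+k_\infty-k$, where $k_0=\min\{i\mid \mu_i=\mu_k\}$ and $k_\infty=\max\{i\mid\mu_i=\mu_k\}$. Write $A=J(R,S)=(a_{i,j})$ and $D=J(p^n-R,p^n-S)=(d_{i,j})$. For a nonnegative integer $i$ and a positive integer $z$ define elements of $F$ by \[A_i(z)=\sum_{j=1}^k a_{k+1-j,j}\binom{\mu_k-1}{i p^n+R-k+j-z},\qquad D_i(z)=\sum_{j=1}^{k-e}d_{k-e+1-j,j}\binom{\mu_k-1}{i p^n+R+S+j-k-z},\] and for a nonnegative integer $t$ define \[f_t(z)=\sum_{i=0}^t (-1)^i A_i(z)+(-1)^{R}\sum_{i=0}^{t}(-1)^i D_i(z).\] Then $f_t(z)=(-1)^{z-1}$ in $F$ whenever $1\le z\le t p^n+p^n-S+k'$.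
   Context: $p$ is a prime, $F$ a field of characteristic $p$, $G=\langle g\rangle$ a cyclic group of order $q=p^a$ ($a$ a positive integer), and $p^n\le q$. $V_q$ is the indecomposable $FG$-module of dimension $q$, with ordered $F$-basis $(v_1,\dots,v_q)$ such that $gv_1=v_1$ and $gv_i=v_{i-1}+v_i$ for $i>1$; $V_i=\langle v_1,\dots,v_i\rangle$, and $V_1,\dots,V_q$ is a complete set of indecomposable $FG$-modules. For $1\le r,s\le q$ write $V_r\otimes V_s\cong V_{\lambda_1}\oplus\dots\oplus V_{\lambda_{\min(r,s)}}$ with $\lambda_1\ge\dots\ge\lambda_{\min(r,s)}>0$. The elements $v_{i,j}=v_i\otimes g^{n-i}v_j$ ($1\le i\le r$, $1\le j\le s$) form a basis of $V_r\otimes V_s$ satisfying $(g-1)v_{i,j}=v_{i-1,j}+v_{i,j-1}$ (with $v_{i,j}=0$ if $i\le0$ or $j\le 0$); any fixed integer $n$ in the exponent may be used. Put $D_d=\langle v_{i,j}\mid i+j=d+1\rangle$ for $1\le d\le r+s-1$ and $x_d=\sum_{i=1}^d(-1)^{i-1}v_{i,d+1-i}$ for $1\le d\le\min(r,s)$. Definition of the $r\times s$ matrix $J(r,s)$ over $F$ ($1\le r,s\le q$). For $1\le\ell\le\min(r,s)$ let $\ell_0=\min\{i\mid\lambda_i=\lambda_\ell\}$. (i) If $\ell=\ell_0$, the entries $J(r,s)_{\ell+1-j,j}$, $1\le j\le\ell$, are the coefficients of the unique element $y=\sum_{j=1}^{\ell}J(r,s)_{\ell+1-j,j}\,v_{r-\ell+j,s+1-j}\in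 D_{r+s-\ell}$ with $(g-1)^{\lambda_\ell-1}(y)=x_{r+s+1-\ell-\lambda_\ell}$ (existence and uniqueness hold). (ii) If $\ell>\ell_0$, then $J(r,s)_{\ell+1-j,j}=(-1)^{\ell-\ell_0}J(r,s)_{\ell_0+1-j,j}$ for $1\le j\le\ell_0$ and $J(r,s)_{\ell+1-j,j}=0$ for $\ell_0<j\le\ell$. (iii) $J(r,s)_{i,j}=0$ if $i+j-1>\min(r,s)$. Binomial coefficients $\binom{c}{d}$ are $0$ if $d<0$ or $d>c$, and are regarded as elements of $F$. *)

theory Defs
  imports
    "Jordan_Normal_Form.Jordan_Normal_Form"
    "HOL-Algebra.Multiplicative_Group"
    "HOL-Computational_Algebra.Computational_Algebra"
begin

section \<open>Matrix representations of a group\<close>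

text \<open>A finite-dimensional module over the group algebra of \<open>G\<close> is given by the family of
  matrices by which the elements of \<open>G\<close> act (on column vectors).\<close>

definition is_rep :: "('g, 'b) monoid_scheme \<Rightarrow> nat \<Rightarrow> ('g \<Rightarrow> 'a::field mat) \<Rightarrow> bool" where
  "is_rep G d \<rho> \<longleftrightarrow>
     (\<forall>x\<in>carrier G. \<rho> x \<in> carrier_mat d d) \<and> \<rho> \<one>\<^bsub>G\<^esub> = 1\<^sub>m d \<and>
     (\<forall>x\<in>carrier G. \<forall>y\<in>carrier G. \<rho> (x \<otimes>\<^bsub>G\<^esub> y) = \<rho> x * \<rho> y)"

definition rep_iso ::
    "('g, 'b) monoid_scheme \<Rightarrow> ('g \<Rightarrow> 'a::field mat) \<Rightarrow> ('g \<Rightarrow> 'a mat) \<Rightarrow> bool" where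
  "rep_iso G \<rho> \<sigma> \<longleftrightarrow>
     (\<exists>d. \<exists>P\<in>carrier_mat d d. invertible_mat P \<and>
        (\<forall>x\<in>carrier G. \<rho> x \<in> carrier_mat d d \<and> \<sigma> x \<in> carrier_mat d d \<and> P * \<rho> x = \<sigma> x * P))"

text \<open>Kronecker products; the (zero-based) basis vector number \<open>i * s + j\<close> of the
  tensor product is the tensor of the basis vectors number \<open>i\<close> and \<open>j\<close>, where \<open>s\<close> is the
  dimension of the second factor.\<close>

definition kron_mat :: "'a::field mat \<Rightarrow> 'a mat \<Rightarrow> 'a mat" where
  "kron_mat A B = mat (dim_row A * dim_row B) (dim_col A * dim_col B)
     (\<lambda>(i, j). A $$ (i div dim_row B, j div dim_col B) * B $$ (i mod dim_row B, j mod dim_col B))"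

definition kron_vec :: "'a::field vec \<Rightarrow> 'a vec \<Rightarrow> 'a vec" where
  "kron_vec u w = vec (dim_vec u * dim_vec w) (\<lambda>i. u $ (i div dim_vec w) * w $ (i mod dim_vec w))"

definition rep_tensor :: "('g \<Rightarrow> 'a::field mat) \<Rightarrow> ('g \<Rightarrow> 'a mat) \<Rightarrow> 'g \<Rightarrow> 'a mat" where
  "rep_tensor \<rho> \<sigma> x = kron_mat (\<rho> x) (\<sigma> x)"

definition rep_dsum :: "('g \<Rightarrow> 'a::field mat) list \<Rightarrow> 'g \<Rightarrow> 'a mat" where
  "rep_dsum \<rho>s x = diag_block_mat (map (\<lambda>\<rho>. \<rho> x) \<rho>s)"


section \<open>The modules \<open>V\<^sub>r\<close> of a cyclic group\<close>

text \<open>Here \<open>g\<close> generates the finite group \<open>G\<close>.  In the basis \<open>v\<^sub>1, \<dots>, v\<^sub>r\<close> the generator acts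
  by \<open>g v\<^sub>1 = v\<^sub>1\<close> and \<open>g v\<^sub>i = v\<^bsub>i-1\<^esub> + v\<^sub>i\<close>, that is, by \<open>jordan_block r 1\<close>; the vector \<open>v\<^sub>i\<close> is
  \<open>unit_vec r (i - 1)\<close>.  An arbitrary element acts by the power of that matrix with its
  least exponent in terms of \<open>g\<close>.  This is a module for \<open>r \<le> order G\<close> (lemma \<open>is_rep_V_rep\<close>).\<close>

definition V_rep :: "('g, 'b) monoid_scheme \<Rightarrow> 'g \<Rightarrow> nat \<Rightarrow> 'g \<Rightarrow> 'a::field mat" where
  "V_rep G g r x = jordan_block r 1 ^\<^sub>m (LEAST k::nat. g [^]\<^bsub>G\<^esub> k = x)"

text \<open>\<open>\<rho> \<cong> V\<^bsub>ls!0\<^esub> \<oplus> V\<^bsub>ls!1\<^esub> \<oplus> \<dots>\<close> with \<open>m\<close> summands of weakly decreasing positive dimension.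
  If \<open>\<rho>\<close> is a representation, then so is the direct sum, so no part can exceed \<open>order G\<close>.\<close>

definition decomposes_into ::
    "('g, 'b) monoid_scheme \<Rightarrow> 'g \<Rightarrow> ('g \<Rightarrow> 'a::field mat) \<Rightarrow> nat \<Rightarrow> nat list \<Rightarrow> bool" where
  "decomposes_into G g \<rho> m ls \<longleftrightarrow>
     length ls = m \<and> sorted_wrt (\<ge>) ls \<and> (\<forall>l\<in>set ls. 0 < l) \<and>
     rep_iso G \<rho> (rep_dsum (map (V_rep G g) ls))"

abbreviation V_tensor ::
    "('g, 'b) monoid_scheme \<Rightarrow> 'g \<Rightarrow> nat \<Rightarrow> nat \<Rightarrow> 'g \<Rightarrow> 'a::field mat" where
  "V_tensor G g r s \<equiv> rep_tensor (V_rep G g r) (V_rep G g s)"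

text \<open>One-based access to lists and matrices.\<close>

abbreviation part :: "nat list \<Rightarrow> nat \<Rightarrow> nat" where
  "part ls i \<equiv> ls ! (i - 1)"

abbreviation entry :: "'a mat \<Rightarrow> nat \<Rightarrow> nat \<Rightarrow> 'a" where
  "entry A i j \<equiv> A $$ (i - 1, j - 1)"

definition first_eq :: "nat list \<Rightarrow> nat \<Rightarrow> nat" where
  "first_eq ls l = Min {i \<in> {1..length ls}. part ls i = part ls l}"

definition last_eq :: "nat list \<Rightarrow> nat \<Rightarrow> nat" where
  "last_eq ls l = Max {i \<in> {1..length ls}. part ls i = part ls l}"


section \<open>The matrix \<open>J(r,s)\<close>\<close>

text \<open>\<open>v\<^bsub>i,j\<^esub> = v\<^sub>i \<otimes> g\<^bsup>N-i\<^esup> v\<^sub>j\<close>, where \<open>N\<close> is an integer that may be chosen freely.\<close>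

definition v_basis ::
    "('g, 'b) monoid_scheme \<Rightarrow> 'g \<Rightarrow> int \<Rightarrow> nat \<Rightarrow> nat \<Rightarrow> nat \<Rightarrow> nat \<Rightarrow> 'a::field vec" where
  "v_basis G g N r s i j =
     (if i = 0 \<or> j = 0 then 0\<^sub>v (r * s)
      else kron_vec (unit_vec r (i - 1))
             (V_rep G g s (g [^]\<^bsub>G\<^esub> (N - int i)) *\<^sub>v unit_vec s (j - 1)))"

definition x_vec ::
    "('g, 'b) monoid_scheme \<Rightarrow> 'g \<Rightarrow> int \<Rightarrow> nat \<Rightarrow> nat \<Rightarrow> nat \<Rightarrow> 'a::field vec" where
  "x_vec G g N r s d =
     finsum_vec TYPE('a) (r * s) (\<lambda>i. (- 1) ^ (i - 1) \<cdot>\<^sub>v v_basis G g N r s i (d + 1 - i)) {1..d}"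

text \<open>The coefficients, extended by zero, of the unique \<open>y\<close> in the span of the \<open>v\<^bsub>i,j\<^esub>\<close> with
  \<open>i + j = r + s - l + 1\<close> such that \<open>(g - 1)\<^bsup>\<lambda>-1\<^esup> y = x\<^bsub>r+s+1-l-\<lambda>\<^esub>\<close>, where \<open>\<lambda> = lam\<close> is the \<open>l\<close>-th
  part of the decomposition of \<open>V\<^sub>r \<otimes> V\<^sub>s\<close>.\<close>

definition y_coeffs ::
    "('g, 'b) monoid_scheme \<Rightarrow> 'g \<Rightarrow> int \<Rightarrow> nat \<Rightarrow> nat \<Rightarrow> nat \<Rightarrow> nat \<Rightarrow> nat \<Rightarrow> 'a::field" where
  "y_coeffs G g N r s l lam = (THE c.
     (\<forall>j. j \<notin> {1..l} \<longrightarrow> c j = 0) \<and>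
     (V_tensor G g r s g - 1\<^sub>m (r * s)) ^\<^sub>m (lam - 1) *\<^sub>v
        finsum_vec TYPE('a) (r * s)
          (\<lambda>j. c j \<cdot>\<^sub>v v_basis G g N r s (r - l + j) (s + 1 - j)) {1..l}
     = x_vec G g N r s (r + s + 1 - l - lam))"

text \<open>In \<open>J_mat\<close> the zero-based position \<open>(i, j)\<close> lies on the antidiagonal of index
  \<open>l = i + j + 1\<close>, and its one-based column index is \<open>j + 1\<close>.\<close>

definition J_mat :: "('g, 'b) monoid_scheme \<Rightarrow> 'g \<Rightarrow> int \<Rightarrow> nat \<Rightarrow> nat \<Rightarrow> 'a::field mat" where
  "J_mat G g N r s =
     (let ls = (THE ls. decomposes_into G g (V_tensor G g r s :: 'g \<Rightarrow> 'a mat) (min r s) ls)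
      in mat r s (\<lambda>(i, j).
           let l = i + j + 1; l0 = first_eq ls l in
           if l > min r s then 0
           else if l = l0 then y_coeffs G g N r s l (part ls l) (j + 1)
           else if j + 1 \<le> l0 then (- 1) ^ (l - l0) * y_coeffs G g N r s l0 (part ls l0) (j + 1)
           else 0))"

definition binom :: "nat \<Rightarrow> int \<Rightarrow> 'a::field" where
  "binom c d = (if d < 0 \<or> d > int c then 0 else of_nat (c choose nat d))"


section \<open>The modules \<open>V\<^sub>r\<close> are modules\<close>

lemma prime_power_dvd_choose:
  assumes "prime (p::nat)" "0 < j" "j < p ^ a"
  shows "p dvd (p ^ a choose j)"
proof (rule ccontr)
  assume "\<not> p dvd (p ^ a choose j)"
  then have "coprime (p ^ a) (p ^ a choose j)"
    using assms(1) by (simp add: prime_imp_coprime)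
  moreover have "j * (p ^ a choose j) = p ^ a * ((p ^ a - 1) choose (j - 1))"
    using assms(2) times_binomial_minus1_eq by blast
  ultimately have "p ^ a dvd j"
    by (metis coprime_dvd_mult_left_iff dvd_triv_left)
  then show False
    using assms(2,3) by (simp add: nat_dvd_not_less)
qed

lemma jordan_block_pow_CHAR:
  assumes "prime CHAR('a::field)" "r \<le> CHAR('a) ^ a"
  shows "jordan_block r (1::'a) ^\<^sub>m (CHAR('a) ^ a) = 1\<^sub>m r"
proof (rule eq_matI)
  fix i j assume "i < dim_row (1\<^sub>m r :: 'a mat)" "j < dim_col (1\<^sub>m r :: 'a mat)"
  then have ij: "i < r" "j < r" by auto
  have "of_nat (CHAR('a) ^ a choose (j - i)) = (0::'a)" if "i < j"
    using prime_power_dvd_choose[OF assms(1), of "j - i" a] that ij assms(2)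
    by (simp add: of_nat_eq_0_iff_char_dvd)
  then show "(jordan_block r (1::'a) ^\<^sub>m (CHAR('a) ^ a)) $$ (i, j) = 1\<^sub>m r $$ (i, j)"
    using ij by (auto simp: jordan_block_pow)
qed (auto simp: jordan_block_pow)

lemma is_rep_V_rep:
  fixes G :: "('g, 'b) monoid_scheme" (structure)
  assumes G: "group G" "g \<in> carrier G" "generate G {g} = carrier G"
    and char: "prime CHAR('a::field)" "order G = CHAR('a) ^ a"
    and r: "r \<le> order G"
  shows "is_rep G r (V_rep G g r :: 'g \<Rightarrow> 'a mat)"
proof -
  interpret group G by fact
  let ?J = "jordan_block r (1::'a)"
  have J: "?J \<in> carrier_mat r r" by simp
  have pos: "order G > 0" using char prime_gt_0_nat by simp
  have ord: "group.ord G g = order G"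
    using G(2,3) generate_pow_card by (simp add: order_def)
  have add: "?J ^\<^sub>m (b + c) = ?J ^\<^sub>m b * ?J ^\<^sub>m c" for b c
    by (induction c) (auto simp flip: assoc_mult_mat[OF pow_carrier_mat[OF J] pow_carrier_mat[OF J] J])
  have period: "?J ^\<^sub>m (order G * c) = 1\<^sub>m r" for c
    using jordan_block_pow_CHAR[OF char(1), of r a] char(2) r
    by (induction c) (auto simp: add)
  have eqJ: "?J ^\<^sub>m k = ?J ^\<^sub>m l" if "g [^] k = g [^] l" for k l :: nat
    using that
  proof (induction k l rule: linorder_wlog)
    case (le k l)
    have "g [^] (l - k) = \<one>"
      by (rule pow_eq_div2) (use G(2) le in auto)
    then have "order G dvd l - k"
      using pow_eq_id G(2) ord by metis
    then obtain c where "l = k + order G * c"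
      using le(1) by (metis dvdE le_add_diff_inverse)
    then show ?case by (simp add: add period)
  next
    case (sym k l)
    then show ?case by simp
  qed
  have V: "V_rep G g r (g [^] k) = ?J ^\<^sub>m k" for k :: nat
    unfolding V_rep_def by (rule eqJ) (rule LeastI[of _ k], simp)
  have ex: "\<exists>k::nat. x = g [^] k" if "x \<in> carrier G" for x
    using that G(2,3) generate_pow_nat[OF G(2)] ord pos by auto
  show ?thesis
    unfolding is_rep_def
  proof (intro conjI ballI)
    fix x y assume "x \<in> carrier G" "y \<in> carrier G"
    then obtain k l :: nat where kl: "x = g [^] k" "y = g [^] l" using ex by meson
    show "V_rep G g r (x \<otimes> y) = V_rep G g r x * (V_rep G g r y :: 'a mat)"
      using kl by (simp add: nat_pow_mult G(2) V flip: add)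
  next
    show "V_rep G g r \<one> = (1\<^sub>m r :: 'a mat)" using V[of 0] by simp
  qed (auto dest!: ex simp: V)
qed

end

theory Submission
  imports Defs "Jordan_Normal_Form.Jordan_Normal_Form_Uniqueness"
begin

hide_const (open) up_ring.coeff up_ring.monom Module.smult

text \<open>Reading \<open>v\<^bsub>i,j\<^esub>\<close> as \<open>X\<^bsup>r-i\<^esup> Y\<^bsup>s-j\<^esup>\<close> turns \<open>V\<^sub>r \<otimes> V\<^sub>s\<close> into the graded algebra
  \<open>F[X,Y]/(X\<^sup>r, Y\<^sup>s)\<close>, on which \<open>g - 1\<close> is multiplication by \<open>X + Y\<close>; homogeneous elements are
  handled as polynomials in \<open>X\<close> by setting \<open>Y = 1\<close>.  A generator \<open>y\<close> of a Jordan block of size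
  \<open>h\<close> that ends in \<open>x\<^sub>d\<close> then amounts to a relation \<open>(1 + X)\<^sup>h y = X\<^sup>r U + V\<close> with
  \<open>deg U \<le> s - d\<close>, \<open>deg V \<le> r - d\<close> and \<open>U(-1) = 1\<close>.  As in the theory of Pade approximants,
  counting dimensions and comparing degrees of the minors \<open>U V' - U' V\<close> yields the partition and
  the uniqueness of \<open>y\<close>.  Since \<open>(1 + X)\<^sup>q = X\<^sup>q + 1\<close> for \<open>q = p\<^sup>n\<close>, the pair \<open>(V, -U)\<close> satisfies
  the same relation for \<open>(q - r, q - s)\<close>, so \<open>A\<^sub>i(z)\<close> and \<open>D\<^sub>i(z)\<close> are coefficients of
  \<open>(X\<^sup>R U + V)/(1 + X)\<close> and \<open>\<plusminus>(X\<^bsup>q-R\<^esup> V - U)/(1 + X)\<close>.  In the alternating sum \<open>V\<close> cancels, and what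
  remains is \<open>U (X\<^bsup>(t+1)q\<^esup> \<plusminus> 1)/(1 + X)\<close>, whose top coefficients alternate in sign.\<close>

section \<open>Approximating pairs of polynomials\<close>

text \<open>The definition of J attaches its generator to the first index k_0 of a run of equal
  parts, whereas the string it generates ends in x_d with d the last index k_\<infinity>. The
  identity \<mu>_k + k_0 + k_\<infinity> = r + s + 1 ties the two together, and uniqueness is
  established at that last index. So the argument is organised by runs, and the parts never have to
  be computed.

  This also explains k'. For k > k_0 the antidiagonal of J is that of k_0, shifted with signs: the
  generator is multiplied by (-X)^(k-k_0). This keeps U(-1) = 1 but relaxes deg U \<le> S -
  k_\<infinity> to deg U \<le> S - k_\<infinity> + (k - k_0) = S - k'. With N = (t + 1) p^n, the
  coefficient of X^(N-z) is forced by the alternation as long as N - z \<ge> S - k', which is the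
  stated range of z.

  The second family of sums uses the index k - e because the degree bounds for (V, -U) are shifted
  by q - r - s; k > max(e, 0) makes this index positive and keeps the height below q, where duality
  is available.\<close>

lemma linear_dvd_iff: "[:1, 1:] dvd p \<longleftrightarrow> poly p (-1) = 0" for p :: "'a::field poly"
  using poly_eq_0_iff_dvd[of p "-1"] by simp

lemma linear_power_dvd_mult_cancel:
  fixes p q :: "'a::field poly"
  assumes "[:1, 1:] ^ h dvd p * q" "poly p (-1) \<noteq> 0"
  shows "[:1, 1:] ^ h dvd q"
proof -
  define T :: "'a poly" where "T = [:1, 1:]"
  have T: "T \<noteq> 0" by (simp add: T_def)
  have "T ^ h dvd q" if "T ^ h dvd p * q" for h
    using that
  proof (induction h arbitrary: q)
    case (Suc h)
    have "T dvd p * q"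
      using Suc.prems by (metis dvd_mult_left power_Suc)
    then have "T dvd q"
      using assms(2) by (simp add: T_def linear_dvd_iff)
    then obtain q' where q: "q = T * q'" by blast
    have "T * T ^ h dvd T * (p * q')"
      using Suc.prems q by (simp add: mult.left_commute)
    then have "T ^ h dvd p * q'"
      using T by simp
    then show ?case
      using Suc.IH q by (metis mult_dvd_mono dvd_refl power_Suc)
  qed simp
  then show ?thesis using assms(1) by (simp add: T_def)
qed

lemma degree_linear_power: "degree ([:1, 1:] ^ h :: 'a::field poly) = h"
  by (simp add: degree_power_eq)

lemma linear_power_dvd_degree:
  "p \<noteq> 0 \<Longrightarrow> [:1, 1:] ^ h dvd p \<Longrightarrow> h \<le> degree p" for p :: "'a::field poly"
  using dvd_imp_degree_le degree_linear_power by metis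

lemma ex_nontrivial_solution:
  fixes a :: "nat \<Rightarrow> nat \<Rightarrow> 'a::field"
  assumes "h < N"
  shows "\<exists>c. (\<exists>i<N. c i \<noteq> 0) \<and> (\<forall>j<h. (\<Sum>i<N. c i * a j i) = 0)"
proof -
  \<comment> \<open>Padding the \<open>h\<close> equations with zero rows makes the system square;
    row \<open>h\<close> exists because \<open>h < N\<close>, and it is zero, so the determinant
    vanishes.\<close>
  define A where "A = mat N N (\<lambda>(j, i). if j < h then a j i else 0)"
  have A: "A \<in> carrier_mat N N" by (simp add: A_def)
  have "\<exists>v\<in>carrier_vec N. v \<noteq> 0\<^sub>v N \<and> A *\<^sub>v v = 0\<^sub>v N"
  proof -
    have "A = mat\<^sub>r N N (\<lambda>j. if j = h then 0\<^sub>v N else row A j)"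
      by (rule eq_matI) (auto simp: A_def mat_of_rows_def)
    moreover have "det (mat\<^sub>r N N (\<lambda>j. if j = h then 0\<^sub>v N else row A j)) = 0"
      using assms A by (intro det_row_0) auto
    ultimately have "det A = 0" by simp
    then show ?thesis using det_0_iff_vec_prod_zero_field[OF A] by auto
  qed
  then obtain v where v: "v \<in> carrier_vec N" "v \<noteq> 0\<^sub>v N" "A *\<^sub>v v = 0\<^sub>v N" by blast
  have "\<exists>i<N. v $ i \<noteq> 0" using v(1,2) by auto
  moreover have "(\<Sum>i<N. v $ i * a j i) = 0" if "j < h" for j
  proof -
    have "(A *\<^sub>v v) $ j = 0" using v(3) that assms by simp
    then show ?thesis using that assms v(1)
      by (simp add: A_def scalar_prod_def atLeast0LessThan mult.commute)
  qed
  ultimately show ?thesis by (intro exI[of _ "\<lambda>i. v $ i"]) auto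
qed

text \<open>Divisibility by (1 + X)^h amounts to \<open>h\<close> linear conditions, one for each
  coefficient of the remainder.\<close>

lemma ex_combination_dvd:
  fixes b :: "nat \<Rightarrow> 'a::field poly"
  assumes "h < N"
  shows "\<exists>c. (\<exists>i<N. c i \<noteq> 0) \<and> [:1, 1:] ^ h dvd (\<Sum>i<N. smult (c i) (b i))"
proof -
  define T :: "'a poly" where "T = [:1, 1:] ^ h"
  have T: "T \<noteq> 0" "degree T = h" by (simp_all add: T_def degree_linear_power)
  obtain c where c: "\<exists>i<N. c i \<noteq> 0" "\<And>j. j < h \<Longrightarrow> (\<Sum>i<N. c i * coeff (b i mod T) j) = 0"
    using ex_nontrivial_solution[OF assms, of "\<lambda>j i. coeff (b i mod T) j"] by blast
  have coeff: "coeff (b i mod T) j = 0" if "j \<ge> h" for i j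
    using degree_mod_less[OF T(1), of "b i"] that T(2)
    by (metis coeff_0 coeff_eq_0 less_le_trans)
  have mod: "(\<Sum>i\<in>I. smult (c i) (b i)) mod T = (\<Sum>i\<in>I. smult (c i) (b i mod T))"
    if "finite I" for I
    using that by (induction) (auto simp: poly_mod_add_left mod_smult_left)
  have "(\<Sum>i<N. smult (c i) (b i)) mod T = 0"
  proof (rule poly_eqI)
    fix j show "coeff ((\<Sum>i<N. smult (c i) (b i)) mod T) j = coeff 0 j"
      using c(2)[of j] coeff[of j] by (cases "j < h") (auto simp: mod coeff_sum)
  qed
  then show ?thesis using c(1) by (auto simp: T_def)
qed

text \<open>\<open>d\<close> is the slack that both degrees leave below \<open>s\<close> and
  \<open>r\<close>, and \<open>h\<close> is the order of vanishing at -1. The two are competing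
  demands.\<close>

definition pade :: "nat \<Rightarrow> nat \<Rightarrow> nat \<Rightarrow> nat \<Rightarrow> 'a::field poly \<Rightarrow> 'a poly \<Rightarrow> bool" where
  "pade r s d h U V \<longleftrightarrow>
     degree U + d \<le> s \<and> degree V + d \<le> r \<and> [:1, 1:] ^ h dvd monom 1 r * U + V"

text \<open>A pair with U(-1) = 0 and \<open>h > 0\<close> has the common factor 1 + X; the
  condition on \<open>U\<close> singles out the pairs without it.\<close>

definition pade_at :: "'a::field itself \<Rightarrow> nat \<Rightarrow> nat \<Rightarrow> nat \<Rightarrow> nat \<Rightarrow> bool" where
  "pade_at ty r s d h \<longleftrightarrow> (\<exists>U V :: 'a poly. pade r s d h U V \<and> poly U (-1) \<noteq> 0)"

text \<open>These numbers turn out to be the parts of the decomposition: the \<open>d\<close>-th one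
  is the size of the Jordan block that ends in x_d.\<close>

definition height :: "'a::field itself \<Rightarrow> nat \<Rightarrow> nat \<Rightarrow> nat \<Rightarrow> nat" where
  "height ty r s d = Max {h. pade_at ty r s d h}"

text \<open>Cross-multiplying the two relations by \<open>U\<close> and \<open>U'\<close> cancels
  the terms with X^r, so the minor inherits the smaller of the two orders.\<close>

lemma pade_minor_dvd:
  assumes "pade r s d h U V" "pade r s d' h' U' V'" "h \<le> h'"
  shows "[:1, 1:] ^ h dvd U * V' - U' * V"
proof -
  have "[:1, 1:] ^ h dvd monom 1 r * U + V" "[:1, 1:] ^ h dvd monom 1 r * U' + V'"
    using assms by (auto simp: pade_def intro: dvd_trans[OF le_imp_power_dvd])
  then have "[:1, 1:] ^ h dvd U * (monom 1 r * U' + V') - U' * (monom 1 r * U + V)"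
    by (intro dvd_diff dvd_mult)
  then show ?thesis by (simp add: algebra_simps)
qed

lemma pade_minor_degree:
  assumes "pade r s d h U V" "pade r s d' h' U' V'"
  shows "degree (U * V' - U' * V) + d + d' \<le> r + s"
proof -
  have "degree (U * V') + d + d' \<le> r + s" "degree (U' * V) + d + d' \<le> r + s"
    using assms degree_mult_le[of U V'] degree_mult_le[of U' V] by (auto simp: pade_def)
  then show ?thesis
    using degree_diff_le_max[of "U * V'" "U' * V"] by (simp add: max_def split: if_splits)
qed

text \<open>A vanishing minor makes the pairs proportional: U' (X^r U + V) = U (X^r U' + V'). As
  U'(-1) \<noteq> 0, the order of the second pair passes to the first.\<close>

lemma pade_transfer:
  assumes "pade r s d h U V" "pade r s d' h' U' V'" "U * V' = U' * V" "poly U' (-1) \<noteq> 0"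
    and "h' \<ge> h"
  shows "pade r s d h' U V"
proof -
  have "U' * (monom 1 r * U + V) = U * (monom 1 r * U' + V')"
    using assms(3) by (simp add: algebra_simps)
  then have "[:1, 1:] ^ h' dvd U' * (monom 1 r * U + V)"
    using assms(2) by (simp add: pade_def)
  then show ?thesis
    using linear_power_dvd_mult_cancel assms(1,4) by (auto simp: pade_def)
qed

lemma pade_poly_eq:
  assumes "pade r s d h U V" "h > 0"
  shows "poly V (-1) = - ((-1) ^ r * poly U (-1))"
proof -
  have "[:1, 1:] dvd monom 1 r * U + V"
    using assms by (auto simp: pade_def intro: dvd_trans[OF dvd_power])
  then show ?thesis
    by (simp add: linear_dvd_iff poly_monom add.inverse_unique)
qed

text \<open>Since \<open>d > 0\<close> keeps deg V below \<open>r\<close>, the terms of X^r U and of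
  \<open>V\<close> do not overlap.\<close>

lemma pade_residual:
  assumes "pade r s d h U V" "d > 0" "poly U (-1) \<noteq> 0"
  shows "monom 1 r * U + V \<noteq> 0" "degree (monom 1 r * U + V) + d \<le> r + s"
proof -
  have U: "U \<noteq> 0" using assms(3) by auto
  then have deg: "degree (monom 1 r * U) = r + degree U"
    by (simp add: degree_mult_eq degree_monom_eq)
  moreover have "degree V < r" using assms(1,2) by (auto simp: pade_def)
  ultimately have "degree (monom 1 r * U + V) = r + degree U"
    by (simp add: degree_add_eq_left)
  then show "monom 1 r * U + V \<noteq> 0" "degree (monom 1 r * U + V) + d \<le> r + s"
    using \<open>degree V < r\<close> assms(1) by (auto simp: pade_def)
qed

lemma pade_at_le:
  assumes "pade_at (ty :: 'a::field itself) r s d h" "d > 0"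
  shows "h + d \<le> r + s"
proof -
  obtain U V :: "'a poly" where UV: "pade r s d h U V" "poly U (-1) \<noteq> 0"
    using assms(1) by (auto simp: pade_at_def)
  then have "h \<le> degree (monom 1 r * U + V)"
    using pade_residual[OF UV(1) assms(2) UV(2)]
    by (intro linear_power_dvd_degree) (auto simp: pade_def)
  then show ?thesis using pade_residual[OF UV(1) assms(2) UV(2)] by simp
qed

lemma pade_at_mono:
  "pade_at ty r s d h \<Longrightarrow> d' \<le> d \<Longrightarrow> h' \<le> h \<Longrightarrow> pade_at ty r s d' h'"
  unfolding pade_at_def pade_def
  by (meson add_left_mono le_trans dvd_trans le_imp_power_dvd)

lemma pade_at_bound: "pade_at ty r s d h \<Longrightarrow> d \<le> min r s"
  by (auto simp: pade_at_def pade_def)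

lemma pade_at_1:
  assumes "d \<le> min r s"
  shows "pade_at TYPE('a::field) r s d 1"
  unfolding pade_at_def
proof (intro exI conjI)
  show "pade r s d 1 (1 :: 'a poly) [:- ((-1) ^ r):]"
    using assms by (auto simp: pade_def linear_dvd_iff poly_monom)
qed simp

lemma pade_at_height:
  assumes "d \<in> {1..min r s}"
  shows "pade_at TYPE('a::field) r s d (height TYPE('a) r s d)"
    and "pade_at TYPE('a) r s d h \<Longrightarrow> h \<le> height TYPE('a) r s d"
proof -
  have "h \<le> r + s" if "pade_at TYPE('a) r s d h" for h
    using pade_at_le[OF that] assms by simp
  then have fin: "finite {h. pade_at TYPE('a) r s d h}"
    using finite_subset[OF _ finite_atMost[of "r + s"]] by blast
  have "{h. pade_at TYPE('a) r s d h} \<noteq> {}"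
    using pade_at_1[of d r s, where 'a='a] assms by auto
  then show "pade_at TYPE('a) r s d (height TYPE('a) r s d)"
    using Max_in[OF fin] by (simp add: height_def)
  show "pade_at TYPE('a) r s d h \<Longrightarrow> h \<le> height TYPE('a) r s d"
    using Max_ge[OF fin] by (simp add: height_def)
qed

text \<open>If U(-1) = 0, then 1 + X divides both components, and dividing it out trades one unit of
  \<open>h\<close> for one unit of \<open>d\<close>. As \<open>h + d\<close> is invariant, the two
  inequalities persist; they force \<open>U\<close> and \<open>V\<close> to be nonzero, so that both
  degrees really drop, and they exclude \<open>h = 0\<close>, so the descent stops at a pair with
  U(-1) \<noteq> 0.\<close>

lemma pade_reduce:
  fixes U V :: "'a::field poly"
  assumes "pade r s d h U V" "U \<noteq> 0 \<or> V \<noteq> 0" "r < h + d" "s < h + d"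
  shows "\<exists>i\<le>h. pade_at TYPE('a) r s (d + i) (h - i) \<and> (poly U (-1) = 0 \<longrightarrow> i > 0)"
  using assms
proof (induction h arbitrary: d U V)
  case 0
  then show ?case by (auto simp: pade_def)
next
  case (Suc h)
  define T :: "'a poly" where "T = [:1, 1:]"
  have T: "T \<noteq> 0" "degree T = 1" by (simp_all add: T_def)
  have dvd: "T ^ Suc h dvd monom 1 r * U + V" and deg: "degree U + d \<le> s" "degree V + d \<le> r"
    using Suc.prems(1) unfolding pade_def T_def by blast+
  show ?case
  proof (cases "poly U (-1) = 0")
    case False
    then show ?thesis
      using Suc.prems(1) by (intro exI[of _ 0]) (auto simp: pade_at_def)
  next
    case True
    then have "poly V (-1) = 0"
      using pade_poly_eq[OF Suc.prems(1)] by simp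
    then obtain U' V' where UV: "U = T * U'" "V = T * V'"
      using True unfolding T_def by (metis linear_dvd_iff dvdE)
    have "U \<noteq> 0"
    proof
      assume "U = 0"
      then have "Suc h \<le> degree V"
        using dvd Suc.prems(2) linear_power_dvd_degree[of V "Suc h"] by (simp add: T_def)
      then show False using deg Suc.prems(3) by simp
    qed
    moreover have "V \<noteq> 0"
    proof
      assume "V = 0"
      then have "T ^ Suc h dvd U"
        using dvd linear_power_dvd_mult_cancel[of "Suc h" "monom 1 r" U]
        by (simp add: T_def poly_monom)
      then have "Suc h \<le> degree U"
        using \<open>U \<noteq> 0\<close> linear_power_dvd_degree unfolding T_def by blast
      then show False using deg Suc.prems(4) by simp
    qed
    ultimately have nz: "U' \<noteq> 0" "V' \<noteq> 0" using UV by auto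
    have "T * T ^ h dvd T * (monom 1 r * U' + V')"
      using dvd UV by (simp add: algebra_simps)
    then have "T ^ h dvd monom 1 r * U' + V'" using T(1) by simp
    moreover have "degree U = Suc (degree U')" "degree V = Suc (degree V')"
      using UV T nz by (simp_all add: degree_mult_eq)
    ultimately have "pade r s (Suc d) h U' V'"
      using deg by (simp add: pade_def T_def)
    then obtain i where "i \<le> h" "pade_at TYPE('a) r s (Suc d + i) (h - i)"
      using Suc.IH[of "Suc d" U' V'] nz Suc.prems(3,4) by auto
    then show ?thesis by (intro exI[of _ "Suc i"]) auto
  qed
qed

text \<open>There are (s - d + 1) + (r - d + 1) free coefficients against \<open>h\<close> linear
  conditions.\<close>

lemma ex_pade:
  assumes "d \<le> min r s" "h + 2 * d < r + s + 2"
  shows "\<exists>U V :: 'a::field poly. pade r s d h U V \<and> (U \<noteq> 0 \<or> V \<noteq> 0)"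
proof -
  define a where "a = Suc (s - d)"
  define b where "b = Suc (r - d)"
  have "h < a + b" using assms by (simp add: a_def b_def)
  define B :: "nat \<Rightarrow> 'a poly" where
    "B i = (if i < a then monom 1 (r + i) else monom 1 (i - a))" for i
  from ex_combination_dvd[OF \<open>h < a + b\<close>, of B] obtain c where c: "\<exists>i<a + b. c i \<noteq> 0"
    "[:1, 1:] ^ h dvd (\<Sum>i<a + b. smult (c i) (B i))"
    by metis
  define U where "U = (\<Sum>i<a. monom (c i) i)"
  define V where "V = (\<Sum>i<b. monom (c (a + i)) i)"
  have split: "(\<Sum>i<a + b. F i) = (\<Sum>i<a. F i) + (\<Sum>i<b. F (a + i))" for F :: "nat \<Rightarrow> 'a poly"
    by (induction b) (simp_all add: add.assoc)
  have "(\<Sum>i<a + b. smult (c i) (B i)) = monom 1 r * U + V"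
    unfolding split U_def V_def by (simp add: B_def sum_distrib_left mult_monom smult_monom)
  then have dvd: "[:1, 1:] ^ h dvd monom 1 r * U + V" using c(2) by metis
  have cU: "coeff U i = (if i < a then c i else 0)" for i
    by (simp add: U_def coeff_sum)
  have cV: "coeff V i = (if i < b then c (a + i) else 0)" for i
    by (simp add: V_def coeff_sum)
  have "degree U \<le> s - d" "degree V \<le> r - d"
    by (rule degree_le, simp add: cU cV a_def b_def)+
  then have "degree U + d \<le> s" "degree V + d \<le> r"
    using assms(1) by linarith+
  then have "pade r s d h U V"
    using dvd unfolding pade_def by blast
  moreover have "U \<noteq> 0 \<or> V \<noteq> 0"
  proof -
    obtain i where i: "i < a + b" "c i \<noteq> 0" using c(1) by blast
    then have "coeff U i \<noteq> 0 \<or> coeff V (i - a) \<noteq> 0"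
      by (cases "i < a") (simp_all add: cU cV)
    then show ?thesis by (metis coeff_0)
  qed
  ultimately show ?thesis by blast
qed

section \<open>The heights as a partition of r * s\<close>

lemma height_le:
  "d \<in> {1..min r s} \<Longrightarrow> height TYPE('a::field) r s d + d \<le> r + s"
  using pade_at_le[OF pade_at_height(1)[of d r s, where 'a='a]] by simp

lemma height_pos: "d \<in> {1..min r s} \<Longrightarrow> height TYPE('a::field) r s d \<ge> 1"
  using pade_at_height(2)[OF _ pade_at_1] by simp

lemma height_antimono:
  "d \<in> {1..min r s} \<Longrightarrow> d' \<in> {1..min r s} \<Longrightarrow> d \<le> d' \<Longrightarrow>
    height TYPE('a::field) r s d' \<le> height TYPE('a) r s d"
  by (meson pade_at_height pade_at_mono le_refl)

text \<open>The pairs realising the two heights are not proportional, for otherwise \<open>d\<close>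
  would reach the larger height. Hence their minor is nonzero, has degree at most r + s - d - d',
  and is divisible by 1 + X to the power of the smaller height.\<close>

lemma height_less:
  assumes "d \<in> {1..min r s}" "d' \<in> {1..min r s}"
    and "height TYPE('a::field) r s d < height TYPE('a) r s d'"
  shows "height TYPE('a) r s d + d + d' \<le> r + s"
proof -
  let ?h = "height TYPE('a) r s d" and ?h' = "height TYPE('a) r s d'"
  obtain U V U' V' :: "'a poly" where
    UV: "pade r s d ?h U V" "poly U (-1) \<noteq> 0" and UV': "pade r s d' ?h' U' V'" "poly U' (-1) \<noteq> 0"
    using pade_at_height(1)[OF assms(1), where 'a='a] pade_at_height(1)[OF assms(2), where 'a='a]
    unfolding pade_at_def by blast
  have "U * V' \<noteq> U' * V"
  proof
    assume "U * V' = U' * V"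
    then have "pade r s d ?h' U V"
      using pade_transfer[OF UV(1) UV'(1)] UV'(2) assms(3) by simp
    then have "pade_at TYPE('a) r s d ?h'"
      using UV(2) unfolding pade_at_def by blast
    from pade_at_height(2)[OF assms(1) this] show False
      using assms(3) by simp
  qed
  then have "U * V' - U' * V \<noteq> 0" by simp
  from linear_power_dvd_degree[OF this pade_minor_dvd[OF UV(1) UV'(1)]]
  have "?h \<le> degree (U * V' - U' * V)" using assms(3) by simp
  then show ?thesis
    using pade_minor_degree[OF UV(1) UV'(1)] by simp
qed

definition heights :: "'a::field itself \<Rightarrow> nat \<Rightarrow> nat \<Rightarrow> nat list" where
  "heights ty r s = map (height ty r s) [1..<Suc (min r s)]"

lemma length_heights: "length (heights ty r s) = min r s"
  by (simp add: heights_def del: upt_Suc)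

lemma part_heights:
  assumes "d \<in> {1..min r s}"
  shows "part (heights ty r s) d = height ty r s d"
proof -
  have d: "d - 1 < Suc (min r s) - 1" "1 + (d - 1) = d" using assms by auto
  show ?thesis
    using nth_map_upt[OF d(1), of "height ty r s"] d(2) by (simp only: heights_def)
qed

lemma sorted_heights: "sorted_wrt (\<ge>) (heights TYPE('a::field) r s)"
  unfolding heights_def sorted_wrt_map
  by (intro sorted_wrt_mono_rel[OF _ sorted_wrt_upt]) (auto intro!: height_antimono simp del: upt_Suc)

lemma first_last_eq:
  assumes "l \<in> {1..length ls}"
  shows "first_eq ls l \<in> {1..l}" "last_eq ls l \<in> {l..length ls}"
    and "part ls (first_eq ls l) = part ls l" "part ls (last_eq ls l) = part ls l"
    and "i \<in> {1..length ls} \<Longrightarrow> part ls i = part ls l \<Longrightarrow> first_eq ls l \<le> i \<and> i \<le> last_eq ls l"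
proof -
  let ?B = "{i \<in> {1..length ls}. part ls i = part ls l}"
  have B: "finite ?B" "l \<in> ?B" using assms by auto
  then have "first_eq ls l \<in> ?B" "last_eq ls l \<in> ?B"
    unfolding first_eq_def last_eq_def using Min_in[OF B(1)] Max_in[OF B(1)] by blast+
  moreover have "first_eq ls l \<le> i \<and> i \<le> last_eq ls l" if "i \<in> ?B" for i
    unfolding first_eq_def last_eq_def using Min_le[OF B(1) that] Max_ge[OF B(1) that] by simp
  ultimately show "first_eq ls l \<in> {1..l}" "last_eq ls l \<in> {l..length ls}"
    "part ls (first_eq ls l) = part ls l" "part ls (last_eq ls l) = part ls l"
    "i \<in> {1..length ls} \<Longrightarrow> part ls i = part ls l \<Longrightarrow> first_eq ls l \<le> i \<and> i \<le> last_eq ls l"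
    using B(2) by auto
qed

lemma first_last_eq_cong:
  "part ls i = part ls l \<Longrightarrow> first_eq ls i = first_eq ls l \<and> last_eq ls i = last_eq ls l"
  by (simp add: first_eq_def last_eq_def)

lemma part_eq_between:
  assumes "sorted_wrt (\<ge>) ls" "l \<in> {1..length ls}" "i \<in> {first_eq ls l..last_eq ls l}"
  shows "part ls i = part ls l"
proof -
  note fl = first_last_eq[OF assms(2)]
  have mono: "part ls y \<le> part ls x" if "1 \<le> x" "x \<le> y" "y \<le> length ls" for x y
    using assms(1) that sorted_wrt_nth_less[OF assms(1), of "x - 1" "y - 1"]
    by (cases "x = y") auto
  have "part ls i \<le> part ls (first_eq ls l)" "part ls (last_eq ls l) \<le> part ls i"
    using fl(1,2) assms(3) by (intro mono; simp)+
  then show ?thesis using fl(3,4) by simp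
qed

text \<open>For the lower bound, a pair found by counting dimensions at the first index of the run
  is reduced; \<open>height_less\<close> forces the index where it lands into the same run. For the
  upper bound, the index before the run has a larger height, so \<open>height_less\<close> applies
  to it and the end of the run.\<close>

lemma height_block:
  assumes "d \<in> {1..min r s}"
  defines "ls \<equiv> heights TYPE('a::field) r s"
  shows "height TYPE('a) r s d + first_eq ls d + last_eq ls d = r + s + 1"
proof -
  let ?h = "height TYPE('a) r s"
  define k0 k1 where "k0 = first_eq ls d" and "k1 = last_eq ls d"
  have d: "d \<in> {1..length ls}" using assms by (simp add: length_heights)
  note fl = first_last_eq[OF d, folded k0_def k1_def]
  have mem: "k0 \<in> {1..min r s}" "k1 \<in> {1..min r s}"
    using fl(1,2) d by (auto simp: ls_def length_heights)
  have h: "?h k0 = ?h d" "?h k1 = ?h d"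
    using fl(3,4) part_heights[of _ r s "TYPE('a)"] mem assms(1) by (auto simp: ls_def)
  have out: "?h i \<noteq> ?h d" if "i \<in> {1..min r s}" "i < k0 \<or> k1 < i" for i
    using fl(5)[of i] part_heights[of _ r s "TYPE('a)"] that assms(1)
    by (auto simp: ls_def length_heights)
  have "?h d + k0 + k1 \<ge> r + s + 1"
  proof -
    \<comment> \<open>This is the largest order for which the dimension count succeeds at
      \<open>k0\<close>.\<close>
    let ?n = "r + s + 1 - 2 * k0"
    obtain U V :: "'a poly" where "pade r s k0 ?n U V" "U \<noteq> 0 \<or> V \<noteq> 0"
      using ex_pade[of k0 r s ?n, where 'a='a] mem(1) by auto
    moreover have "r < ?n + k0" "s < ?n + k0" using mem(1) by auto
    ultimately obtain i where i: "i \<le> ?n" "pade_at TYPE('a) r s (k0 + i) (?n - i)"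
      using pade_reduce by blast
    have D: "k0 + i \<in> {1..min r s}" using pade_at_bound[OF i(2)] mem(1) by auto
    have hD: "?h (k0 + i) + (k0 + i) + k0 \<ge> r + s + 1"
      using pade_at_height(2)[OF D i(2)] i(1) mem(1) by auto
    have "?h (k0 + i) = ?h k0"
      using height_less[OF D mem(1), where 'a='a] height_antimono[OF mem(1) D, where 'a='a] hD by linarith
    moreover from this have "k0 + i \<le> k1" using out[OF D] h by force
    ultimately show ?thesis using hD h by linarith
  qed
  moreover have "?h d + k0 + k1 \<le> r + s + 1"
  proof (cases "k0 = 1")
    case True
    then show ?thesis using height_le[OF mem(2), where 'a='a] h by simp
  next
    case False
    then have k: "k0 - 1 \<in> {1..min r s}" "k0 - 1 \<le> k1" using mem fl(1,2) by auto
    then have "?h k1 < ?h (k0 - 1)"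
      using height_antimono[OF k(1) mem(2) k(2), where 'a='a] out[OF k(1)] h mem by auto
    then show ?thesis using height_less[OF mem(2) k(1)] h by fastforce
  qed
  ultimately show ?thesis by (simp add: k0_def k1_def)
qed

text \<open>Reflecting every run of equal heights permutes 1..m, so first plus last index, summed
  over all d, gives m(m + 1). With \<open>height_block\<close> the total is m(r + s + 1) - m(m + 1)
  = m(r + s - m) = rs. This is the dimension count that makes the Jordan strings a basis.\<close>

lemma sum_height: "(\<Sum>d = 1..min r s. height TYPE('a::field) r s d) = r * s"
proof -
  let ?m = "min r s" and ?h = "height TYPE('a) r s"
  define ls where "ls = heights TYPE('a) r s"
  let ?a = "first_eq ls" and ?b = "last_eq ls"
  have len: "length ls = ?m" by (simp add: ls_def length_heights)
  have blk: "?a (?a d + ?b d - d) = ?a d" "?b (?a d + ?b d - d) = ?b d"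
    "?a d + ?b d - d \<in> {1..?m}" "d \<le> ?a d + ?b d" if "d \<in> {1..?m}" for d
  proof -
    have d: "d \<in> {1..length ls}" using that len by simp
    note fl = first_last_eq[OF d]
    have "part ls (?a d + ?b d - d) = part ls d"
      using fl(1,2) d sorted_heights[where 'a='a] by (intro part_eq_between) (auto simp: ls_def)
    then show "?a (?a d + ?b d - d) = ?a d" "?b (?a d + ?b d - d) = ?b d"
      using first_last_eq_cong by blast+
    show "?a d + ?b d - d \<in> {1..?m}" "d \<le> ?a d + ?b d" using fl(1,2) len by auto
  qed
  have "(\<Sum>d = 1..?m. ?a d + ?b d - d) = (\<Sum>d = 1..?m. d)"
    by (rule sum.reindex_bij_witness[of _ "\<lambda>d. ?a d + ?b d - d" "\<lambda>d. ?a d + ?b d - d"])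
      (use blk in auto)
  moreover have "(\<Sum>d = 1..?m. ?a d + ?b d) = (\<Sum>d = 1..?m. (?a d + ?b d - d) + d)"
    using blk(4) by (intro sum.cong) auto
  ultimately have "(\<Sum>d = 1..?m. ?a d + ?b d) = 2 * (\<Sum>d = 1..?m. d)"
    by (simp add: sum.distrib)
  also have "\<dots> = ?m * (?m + 1)"
    using double_gauss_sum_from_Suc_0[of ?m, where 'a=nat] by simp
  finally have ab: "(\<Sum>d = 1..?m. ?a d + ?b d) = ?m * (?m + 1)" .
  have "(\<Sum>d = 1..?m. ?h d) + (\<Sum>d = 1..?m. ?a d + ?b d) = (\<Sum>d = 1..?m. r + s + 1)"
    unfolding sum.distrib[symmetric] using height_block[where 'a='a]
    by (intro sum.cong) (auto simp: ls_def add.assoc)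
  then have "(\<Sum>d = 1..?m. ?h d) + ?m * (?m + 1) = ?m * (r + s + 1)"
    using ab by simp
  then show ?thesis by (cases "r \<le> s") (auto simp: algebra_simps min_def)
qed

section \<open>Generators of the Jordan blocks\<close>

text \<open>This is x_d with Y = 1: the vector v_{i,d+1-i} contributes X^(r-i) with the sign
  (-1)^(i-1).\<close>

definition alt_poly :: "nat \<Rightarrow> nat \<Rightarrow> 'a::field poly" where
  "alt_poly r d = (\<Sum>i\<in>{r - d..<r}. monom ((-1) ^ (r - 1 - i)) i)"

lemma coeff_alt_poly:
  "coeff (alt_poly r d) i = (if i \<in> {r - d..<r} then (-1) ^ (r - 1 - i) else 0 :: 'a::field)"
  by (simp add: alt_poly_def coeff_sum)

lemma coeff_linear_mult:
  "coeff ([:1, 1:] * p) i = coeff p i + (if i = 0 then 0 else coeff p (i - 1))"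
  for p :: "'a::field poly"
  by (cases i) (auto simp: coeff_pCons)

lemma linear_mult_alt_poly:
  assumes "d \<le> r"
  shows "[:1, 1:] * alt_poly r d = (monom 1 r - monom ((-1) ^ d) (r - d) :: 'a::field poly)"
proof (rule poly_eqI)
  fix i
  have step: "(-1) ^ (r - i) + (-1) ^ (r - Suc i) = (0::'a)" if "i < r"
    using that by (simp add: Suc_diff_Suc[symmetric])
  show "coeff ([:1, 1:] * alt_poly r d) i = coeff (monom 1 r - monom ((-1) ^ d) (r - d) :: 'a poly) i"
  proof -
    note coeffs = coeff_linear_mult coeff_alt_poly coeff_diff coeff_monom
    consider "i < r - d" | "i = r - d" "d = 0" | "i = r - d" "d > 0" | "r - d < i" "i < r"
      | "i = r" "d > 0" | "i > r" using assms by linarith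
    then show ?thesis
    proof cases
      case 3
      have "r - Suc (r - d) = d - 1" using 3 assms by simp
      then show ?thesis unfolding coeffs using 3 assms by (cases d) auto
    next
      case 4
      then have "r - d \<le> i - 1" "r - 1 - (i - 1) = r - i" "r - 1 - i = r - Suc i" "i \<noteq> 0"
        by linarith+
      then show ?thesis unfolding coeffs using 4 step by (simp add: add.commute del: diff_diff_left)
    qed (unfold coeffs, use assms in auto)
  qed
qed

text \<open>This says \<open>(g - 1)\<^bsup>h-1\<^esup> y = x\<^sub>d\<close>: in the degree of \<open>x\<^sub>d\<close>, exactly the monomials with
  \<open>X\<close>-exponent in \<open>{r - d..<r}\<close> survive modulo \<open>X\<^sup>r\<close> and \<open>Y\<^sup>s\<close>.\<close>

definition hits_top :: "nat \<Rightarrow> nat \<Rightarrow> nat \<Rightarrow> 'a::field poly \<Rightarrow> bool" where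
  "hits_top r d h y \<longleftrightarrow>
     (\<forall>i\<in>{r - d..<r}. coeff ([:1, 1:] ^ (h - 1) * y) i = (-1) ^ (r - 1 - i))"

lemma degree_linear_mult: "p \<noteq> 0 \<Longrightarrow> degree ([:1, 1:] * p) = Suc (degree p)" for p :: "'a::field poly"
  by (subst degree_mult_eq) auto

text \<open>Cut (1 + X)^(h-1) y at the exponents r - d and r. The middle piece is prescribed, and
  multiplication by 1 + X telescopes it to one monomial at each cut. These supply the 1 in
  \<open>U\<close>, whence U(-1) = 1, and the extra monomial in \<open>V\<close>.\<close>

lemma hits_top_imp_pade:
  fixes y :: "'a::field poly"
  assumes "hits_top r d h y" "degree y + d + h \<le> r + s" "1 \<le> h" "1 \<le> d" "d \<le> min r s"
  shows "\<exists>U V. pade r s d h U V \<and> poly U (-1) = 1 \<and> [:1, 1:] ^ h * y = monom 1 r * U + V"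
proof -
  define T :: "'a poly" where "T = [:1, 1:]"
  define P where "P = T ^ (h - 1) * y"
  define u where "u = poly_shift r P"
  define v where "v = poly_cutoff (r - d) P"
  have degP: "degree P + d + 1 \<le> r + s"
    using assms(2-5) degree_mult_le[of "T ^ (h - 1)" y] degree_linear_power[of "h - 1", where 'a='a]
    unfolding P_def T_def by linarith
  have P: "P = monom 1 r * u + alt_poly r d + v"
  proof (rule poly_eqI)
    fix i show "coeff P i = coeff (monom 1 r * u + alt_poly r d + v) i"
      using assms(1,5)
      by (auto simp: coeff_monom_mult coeff_alt_poly u_def v_def coeff_poly_shift coeff_poly_cutoff
          hits_top_def P_def T_def)
  qed
  define U where "U = 1 + T * u"
  define V where "V = T * v - monom ((-1) ^ d) (r - d)"
  have "T ^ h * y = T * P"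
    using assms(3) by (simp add: P_def power_eq_if mult.assoc)
  also have "\<dots> = monom 1 r * (T * u) + T * alt_poly r d + T * v"
    by (simp add: P algebra_simps)
  also have "\<dots> = monom 1 r * U + V"
    using linear_mult_alt_poly[of d r, where 'a='a] assms(5)
    by (simp add: T_def[symmetric] U_def V_def algebra_simps)
  finally have eq: "T ^ h * y = monom 1 r * U + V" .
  have "degree (T * u) + d \<le> s"
  proof (cases "u = 0")
    case False
    have "coeff P i = 0" if "i \<ge> r + s - d" for i
      using that degP assms(5) by (intro coeff_eq_0) auto
    then have "coeff u i = 0" if "i \<ge> s - d" for i
      using that assms(5) by (simp add: u_def coeff_poly_shift)
    then have "degree u < s - d"
      using False by (metis leading_coeff_0_iff not_le)
    then show ?thesis using degree_linear_mult[OF False] by (simp add: T_def)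
  qed (use assms(5) in simp)
  then have U: "degree U + d \<le> s"
    using degree_add_le_max[of 1 "T * u"] by (auto simp: U_def)
  have "degree (T * v) \<le> r - d"
  proof (cases "v = 0")
    case False
    have "degree v < r - d"
      using False coeff_poly_cutoff[of "r - d" P "degree v"]
      by (auto simp: v_def[symmetric] split: if_splits)
    then show ?thesis using degree_linear_mult[OF False] by (simp add: T_def)
  qed simp
  then have "degree V \<le> r - d"
    unfolding V_def by (intro degree_diff_le) (auto simp: degree_monom_le)
  then have "pade r s d h U V"
    unfolding pade_def T_def[symmetric] eq[symmetric] using U assms(5) by auto
  moreover have "poly U (-1) = 1" by (simp add: U_def T_def)
  ultimately show ?thesis using eq unfolding T_def by blast
qed

text \<open>Both U - 1 and V + (-1)^d X^(r-d) vanish at -1; their quotients by 1 + X are the pieces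
  above and below the prescribed one.\<close>

lemma pade_imp_hits_top:
  fixes y U V :: "'a::field poly"
  assumes pade: "pade r s d h U V" and U: "poly U (-1) = 1"
    and y: "[:1, 1:] ^ h * y = monom 1 r * U + V" and "1 \<le> h" "1 \<le> d"
  shows "hits_top r d h y"
proof -
  define T :: "'a poly" where "T = [:1, 1:]"
  have T: "T \<noteq> 0" by (simp add: T_def)
  have d: "d \<le> r" using pade by (simp add: pade_def)
  have "T dvd U - 1"
    using U by (simp add: T_def linear_dvd_iff)
  then obtain u where u: "U = 1 + T * u"
    by (metis add.commute diff_add_cancel dvdE)
  have "(-1) ^ d * (-1) ^ (r - d) = ((-1) ^ r :: 'a)"
    using d by (simp flip: power_add)
  then have "T dvd V + monom ((-1) ^ d) (r - d)"
    using pade_poly_eq[OF pade] U assms(4) by (simp add: T_def linear_dvd_iff poly_monom)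
  then obtain v where v: "V = T * v - monom ((-1) ^ d) (r - d)"
    by (metis add_diff_cancel_right' dvdE)
  have "T * (T ^ (h - 1) * y) = T ^ h * y"
    using assms(4) by (simp add: power_eq_if mult.assoc)
  also have "\<dots> = monom 1 r * U + V" using y by (simp add: T_def)
  also have "\<dots> = T * (monom 1 r * u + alt_poly r d + v)"
    using linear_mult_alt_poly[OF d, where 'a='a]
    by (simp add: T_def[symmetric] u v algebra_simps)
  finally have P: "T ^ (h - 1) * y = monom 1 r * u + alt_poly r d + v" using T by simp
  have v0: "coeff v i = 0" if "i \<ge> r - d" for i
  proof (cases "v = 0")
    case False
    have "degree (T * v) \<le> r - d"
    proof -
      have "T * v = V + monom ((-1) ^ d) (r - d)" by (simp add: v)
      then show ?thesis
        using pade by (auto simp: pade_def intro!: degree_add_le degree_monom_le)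
    qed
    then have "degree v < r - d" using degree_linear_mult[OF False] by (simp add: T_def)
    then show ?thesis using that by (intro coeff_eq_0) simp
  qed simp
  show ?thesis
    unfolding hits_top_def T_def[symmetric] P
    by (auto simp: coeff_monom_mult coeff_alt_poly v0)
qed

lemma ex_hits_top:
  assumes "d \<in> {1..min r s}"
  shows "\<exists>y :: 'a::field poly. hits_top r d (height TYPE('a) r s d) y \<and>
      degree y + d + height TYPE('a) r s d \<le> r + s"
proof -
  let ?h = "height TYPE('a) r s d"
  obtain U V :: "'a poly" where UV: "pade r s d ?h U V" "poly U (-1) \<noteq> 0"
    using pade_at_height(1)[OF assms, where 'a='a] unfolding pade_at_def by blast
  define c where "c = inverse (poly U (-1))"
  have "[:1, 1:] ^ ?h dvd smult c (monom 1 r * U + V)"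
    using UV(1) by (intro dvd_smult) (simp add: pade_def)
  then have pade: "pade r s d ?h (smult c U) (smult c V)"
    using UV(1) degree_smult_le[of c U] degree_smult_le[of c V]
    by (simp add: pade_def smult_add_right)
  have one: "poly (smult c U) (-1) = 1" using UV(2) by (simp add: c_def)
  obtain y where y: "monom 1 r * smult c U + smult c V = [:1, 1:] ^ ?h * y"
    using pade unfolding pade_def by blast
  have "hits_top r d ?h y"
    using pade_imp_hits_top[OF pade one y[symmetric]] height_pos[OF assms, where 'a='a] assms by simp
  moreover have "degree y + d + ?h \<le> r + s"
  proof -
    have nz1: "poly (smult c U) (-1) \<noteq> 0" and d0: "d > 0" using one assms by simp_all
    have nz: "[:1, 1:] ^ ?h * y \<noteq> 0" and deg: "degree ([:1, 1:] ^ ?h * y) + d \<le> r + s"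
      using pade_residual[OF pade _ nz1] d0 unfolding y by blast+
    have "degree ([:1, 1:] ^ ?h * y) = degree ([:1, 1:] ^ ?h :: 'a poly) + degree y"
      using nz by (intro degree_mult_eq) auto
    then show ?thesis using deg degree_linear_power[of ?h, where 'a='a] by simp
  qed
  ultimately show ?thesis by blast
qed

text \<open>The difference of two solutions gives a nonzero pair with U(-1) = 0, which reduces to
  order h - i at index d + i with i > 0. As \<open>d\<close> ends its run, the height there is below
  \<open>h\<close>, and \<open>height_less\<close> against the first index of the run contradicts
  \<open>height_block\<close>.\<close>

lemma hits_top_unique:
  fixes y y' :: "'a::field poly"
  assumes d: "d \<in> {1..min r s}" and last: "last_eq (heights TYPE('a) r s) d = d"
  defines "h \<equiv> height TYPE('a) r s d"
  assumes y: "hits_top r d h y" "degree y + d + h \<le> r + s"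
    and y': "hits_top r d h y'" "degree y' + d + h \<le> r + s"
  shows "y = y'"
proof (rule ccontr)
  let ?h = "height TYPE('a) r s" and ?ls = "heights TYPE('a) r s"
  assume "y \<noteq> y'"
  have h: "1 \<le> h" using height_pos[OF d] by (simp add: h_def)
  have d1: "1 \<le> d" "d \<le> min r s" using d by simp_all
  obtain U V where
    UV: "pade r s d h U V" "poly U (-1) = 1" "[:1, 1:] ^ h * y = monom 1 r * U + V"
    using hits_top_imp_pade[OF y h d1] by blast
  obtain U' V' where
    UV': "pade r s d h U' V'" "poly U' (-1) = 1" "[:1, 1:] ^ h * y' = monom 1 r * U' + V'"
    using hits_top_imp_pade[OF y' h d1] by blast
  have eq: "[:1, 1:] ^ h * (y - y') = monom 1 r * (U - U') + (V - V')"
    using UV(3) UV'(3) by (simp add: algebra_simps)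
  then have dvd: "[:1, 1:] ^ h dvd monom 1 r * (U - U') + (V - V')"
    by (metis dvd_triv_left)
  have "degree (U - U') + d \<le> s" "degree (V - V') + d \<le> r"
    using UV(1) UV'(1) degree_diff_le_max[of U U'] degree_diff_le_max[of V V']
    unfolding pade_def by linarith+
  then have pade: "pade r s d h (U - U') (V - V')" using dvd unfolding pade_def by blast
  have "monom 1 r * (U - U') + (V - V') \<noteq> 0"
    unfolding eq[symmetric] using \<open>y \<noteq> y'\<close> by simp
  then have nz: "U - U' \<noteq> 0 \<or> V - V' \<noteq> 0" by auto
  have block: "h + first_eq ?ls d + d = r + s + 1"
    using height_block[OF d, where 'a='a] last by (simp add: h_def)
  have dl: "d \<in> {1..length ?ls}" using d by (simp add: length_heights)
  note fl = first_last_eq[OF dl]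
  have k0: "first_eq ?ls d \<in> {1..min r s}" using fl(1) d by auto
  have "poly (U - U') (-1) = 0" using UV(2) UV'(2) by simp
  moreover have "r < h + d" "s < h + d" using block k0 by auto
  ultimately obtain i where i: "i \<le> h" "pade_at TYPE('a) r s (d + i) (h - i)" "i > 0"
    using pade_reduce[OF pade nz] by blast
  have D: "d + i \<in> {1..min r s}" using pade_at_bound[OF i(2)] i(3) by auto
  have "?h (d + i) \<noteq> h"
    using fl(5)[of "d + i"] part_heights[OF D, of "TYPE('a)"] part_heights[OF d, of "TYPE('a)"] D i(3) last
    by (auto simp: h_def length_heights)
  then have "?h (d + i) < h"
    using height_antimono[OF d D, where 'a='a] by (simp add: h_def)
  moreover have "?h (first_eq ?ls d) = h"
    using fl(3) part_heights[OF k0, of "TYPE('a)"] part_heights[OF d, of "TYPE('a)"] by (simp add: h_def)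
  ultimately have "?h (d + i) + (d + i) + first_eq ?ls d \<le> r + s"
    using height_less[OF D k0, where 'a='a] by simp
  then show False using block pade_at_height(2)[OF D i(2)] i(1) by simp
qed

section \<open>Duality\<close>

lemma linear_power_CHAR:
  assumes "prime CHAR('a::field)"
  shows "[:1, 1:] ^ (CHAR('a) ^ n) = monom 1 (CHAR('a) ^ n) + (1 :: 'a poly)"
proof -
  have "[:1, 1:] = monom 1 1 + (1 :: 'a poly)" by (simp add: monom_altdef one_pCons)
  moreover have "(monom 1 1 + (1 :: 'a poly)) ^ (CHAR('a) ^ n) = monom 1 1 ^ (CHAR('a) ^ n) + 1 ^ (CHAR('a) ^ n)"
    using assms by (intro freshmans_dream') simp_all
  ultimately show ?thesis by (simp only: power_one monom_power mult_1)
qed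

text \<open>Subtracting the relation from (1 + X)^q V = X^q V + V leaves X^r (X^(q-r) V - U), and
  X^r does not vanish at -1. The shift of \<open>d\<close> is dictated by the degree bounds.\<close>

lemma pade_dual:
  fixes U V :: "'a::field poly"
  assumes q: "[:1, 1:] ^ q = monom 1 q + (1 :: 'a poly)" and "r \<le> q" "s \<le> q"
    and pade: "pade r s d h U V" and "h \<le> q" "d' + r + s = d + q"
  shows "pade (q - r) (q - s) d' h V (- U)"
proof -
  define T :: "'a poly" where "T = [:1, 1:]"
  have "T ^ h dvd T ^ q" using assms(5) by (simp add: le_imp_power_dvd)
  moreover have "T ^ h dvd monom 1 r * U + V" using pade by (simp add: pade_def T_def)
  ultimately have "T ^ h dvd T ^ q * V - (monom 1 r * U + V)"
    by (metis dvd_diff dvd_mult2)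
  also have "T ^ q * V - (monom 1 r * U + V) = monom 1 r * (monom 1 (q - r) * V + - U)"
    using assms(2) q by (simp add: T_def[symmetric] algebra_simps mult_monom flip: mult.assoc)
  finally have "T ^ h dvd monom 1 (q - r) * V + - U"
    unfolding T_def by (rule linear_power_dvd_mult_cancel) (simp add: poly_monom)
  moreover have "degree V + d' \<le> q - s" "degree (- U) + d' \<le> q - r"
    using pade assms(2,3,6) by (auto simp: pade_def)
  ultimately show ?thesis unfolding pade_def T_def by blast
qed

lemma height_le_dual:
  assumes q: "[:1, 1:] ^ q = monom 1 q + (1 :: 'a::field poly)" and "r < q" "s < q"
    and d: "d \<in> {1..min r s}" "d' + r + s = d + q" "d' \<ge> 1"
  shows "d' \<in> {1..min (q - r) (q - s)}"
    and "height TYPE('a) r s d \<le> height TYPE('a) (q - r) (q - s) d'"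
proof -
  let ?h = "height TYPE('a) r s d"
  show d': "d' \<in> {1..min (q - r) (q - s)}" using assms(2-6) by auto
  obtain U V :: "'a poly" where UV: "pade r s d ?h U V" "poly U (-1) \<noteq> 0"
    using pade_at_height(1)[OF d(1), where 'a='a] unfolding pade_at_def by blast
  have "poly V (-1) \<noteq> 0"
    using pade_poly_eq[OF UV(1)] UV(2) height_pos[OF d(1), where 'a='a] by simp
  \<comment> \<open>The order must not exceed \<open>q\<close>; this follows from
    \<open>height_le\<close>, as d' \<ge> 1 means r + s < d + q.\<close>
  moreover have "pade (q - r) (q - s) d' ?h V (- U)"
    using height_le[OF d(1), where 'a='a] assms(2-6) by (intro pade_dual[OF q _ _ UV(1)]) auto
  ultimately have "pade_at TYPE('a) (q - r) (q - s) d' ?h" unfolding pade_at_def by blast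
  then show "?h \<le> height TYPE('a) (q - r) (q - s) d'" using pade_at_height(2)[OF d'] by blast
qed

lemma height_dual:
  assumes q: "[:1, 1:] ^ q = monom 1 q + (1 :: 'a::field poly)" and rs: "r < q" "s < q" "0 < r" "0 < s"
    and d: "d \<in> {1..min r s}" "d' + r + s = d + q" "d' \<ge> 1"
  shows "height TYPE('a) (q - r) (q - s) d' = height TYPE('a) r s d"
proof (rule antisym)
  show "height TYPE('a) r s d \<le> height TYPE('a) (q - r) (q - s) d'"
    using height_le_dual(2)[OF q rs(1,2) d] .
  have "height TYPE('a) (q - r) (q - s) d' \<le> height TYPE('a) (q - (q - r)) (q - (q - s)) d"
    using rs d height_le_dual(1)[OF q rs(1,2) d] by (intro height_le_dual(2)[OF q]) auto
  then show "height TYPE('a) (q - r) (q - s) d' \<le> height TYPE('a) r s d"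
    using rs by simp
qed

text \<open>The pair (X^(q-r), 1) has order \<open>q\<close>. So the indices d \<le> r + s - q,
  which have no dual index, lie outside every run of height below \<open>q\<close>.\<close>

lemma height_ge:
  assumes q: "[:1, 1:] ^ q = monom 1 q + (1 :: 'a::field poly)" and rs: "r < q" "s < q"
    and d: "d \<in> {1..min r s}" "d + q \<le> r + s"
  shows "q \<le> height TYPE('a) r s d"
proof -
  have "pade r s d q (monom 1 (q - r) :: 'a poly) 1"
    using rs d unfolding pade_def q by (auto simp: mult_monom degree_monom_eq)
  then have "pade_at TYPE('a) r s d q"
    unfolding pade_at_def by (intro exI[of _ "monom 1 (q - r)"] exI[of _ 1]) (auto simp: poly_monom)
  then show ?thesis using pade_at_height(2)[OF d(1)] by blast
qed

lemma first_last_dual_le: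
  fixes r s q :: nat
  defines "ls \<equiv> heights TYPE('a::field) r s" and "ls' \<equiv> heights TYPE('a) (q - r) (q - s)"
  assumes q: "[:1, 1:] ^ q = monom 1 q + (1 :: 'a poly)" and rs: "r < q" "s < q" "0 < r" "0 < s"
    and d: "d \<in> {1..min r s}" "d' + r + s = d + q" "d' \<ge> 1"
  shows "first_eq ls' d' + r + s \<le> first_eq ls d + q" "last_eq ls d + q \<le> last_eq ls' d' + r + s"
proof -
  let ?h = "height TYPE('a) r s" and ?h' = "height TYPE('a) (q - r) (q - s)"
  have dl: "d \<in> {1..length ls}" using d(1) by (simp add: ls_def length_heights)
  note d' = height_le_dual(1)[OF q rs(1,2) d]
  have dl': "d' \<in> {1..length ls'}" using d' by (simp add: ls'_def length_heights)
  \<comment> \<open>With \<open>height_ge\<close> this keeps the whole run of \<open>d\<close> among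
    the indices that have a dual.\<close>
  have "?h d < q" using height_le[OF d(1), where 'a='a] d(2,3) by linarith
  have shift: "i + q - (r + s) \<in> {1..length ls'} \<and> part ls' (i + q - (r + s)) = part ls' d' \<and> i + q > r + s"
    if i: "i \<in> {1..min r s}" "part ls i = part ls d" for i
  proof -
    have "?h i = ?h d"
      using i(2) part_heights[OF i(1), of "TYPE('a)"] part_heights[OF d(1), of "TYPE('a)"]
      by (simp add: ls_def)
    then have iq: "i + q > r + s"
      using height_ge[OF q rs(1,2) i(1)] \<open>?h d < q\<close> by linarith
    define i' where "i' = i + q - (r + s)"
    have i': "i' + r + s = i + q" "i' \<ge> 1" using iq by (simp_all add: i'_def)
    note mem = height_le_dual(1)[OF q rs(1,2) i(1) i']
    have "?h' i' = ?h' d'"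
      using height_dual[OF q rs i(1) i'] height_dual[OF q rs d] \<open>?h i = ?h d\<close> by simp
    then have "part ls' i' = part ls' d'"
      using part_heights[OF mem, of "TYPE('a)"] part_heights[OF d', of "TYPE('a)"] by (simp add: ls'_def)
    then show ?thesis using iq mem by (simp add: i'_def ls'_def length_heights)
  qed
  note fl = first_last_eq[OF dl]
  have mem: "first_eq ls d \<in> {1..min r s}" "last_eq ls d \<in> {1..min r s}"
    using fl(1,2) dl by (auto simp: ls_def length_heights)
  show "first_eq ls' d' + r + s \<le> first_eq ls d + q" "last_eq ls d + q \<le> last_eq ls' d' + r + s"
    using shift[OF mem(1) fl(3)] shift[OF mem(2) fl(4)]
      first_last_eq(5)[OF dl', of "first_eq ls d + q - (r + s)"]
      first_last_eq(5)[OF dl', of "last_eq ls d + q - (r + s)"]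
    by linarith+
qed

text \<open>Duality is an involution, so the inclusion of runs, applied to (q - r, q - s), also
  yields the reverse inequalities.\<close>

lemma first_last_dual:
  fixes r s q :: nat
  defines "ls \<equiv> heights TYPE('a::field) r s" and "ls' \<equiv> heights TYPE('a) (q - r) (q - s)"
  assumes q: "[:1, 1:] ^ q = monom 1 q + (1 :: 'a poly)" and rs: "r < q" "s < q" "0 < r" "0 < s"
    and d: "d \<in> {1..min r s}" "d' + r + s = d + q" "d' \<ge> 1"
  shows "first_eq ls' d' + r + s = first_eq ls d + q" "last_eq ls' d' + r + s = last_eq ls d + q"
proof -
  have "q - (q - r) = r" "q - (q - s) = s" using rs by auto
  then have "first_eq ls d + (q - r) + (q - s) \<le> first_eq ls' d' + q"
    "last_eq ls' d' + q \<le> last_eq ls d + (q - r) + (q - s)"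
    using first_last_dual_le[OF q, of "q - r" "q - s" d' d] rs d height_le_dual(1)[OF q rs(1,2) d]
    by (auto simp: ls_def ls'_def)
  then show "first_eq ls' d' + r + s = first_eq ls d + q" "last_eq ls' d' + r + s = last_eq ls d + q"
    using first_last_dual_le[OF q rs d] rs unfolding ls_def ls'_def by linarith+
qed

text \<open>There is one generator per run: the condition depends on \<open>l\<close> only through
  the height and the last index of its run. By \<open>height_block\<close> the degree bound says
  that deg y is less than the first index of the run.\<close>

definition block_gen :: "nat \<Rightarrow> nat \<Rightarrow> nat \<Rightarrow> 'a::field poly \<Rightarrow> bool" where
  "block_gen r s l y \<longleftrightarrow>
     (let h = height TYPE('a) r s l; l' = last_eq (heights TYPE('a) r s) l
      in hits_top r l' h y \<and> degree y + l' + h \<le> r + s)"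

lemma height_last:
  assumes "l \<in> {1..min r s}"
  shows "last_eq (heights TYPE('a::field) r s) l \<in> {1..min r s}"
    and "height TYPE('a) r s (last_eq (heights TYPE('a) r s) l) = height TYPE('a) r s l"
    and "last_eq (heights TYPE('a) r s) (last_eq (heights TYPE('a) r s) l) = last_eq (heights TYPE('a) r s) l"
proof -
  let ?ls = "heights TYPE('a) r s"
  have l: "l \<in> {1..length ?ls}" using assms by (simp add: length_heights)
  note fl = first_last_eq[OF l]
  show mem: "last_eq ?ls l \<in> {1..min r s}" using fl(2) l by (auto simp: length_heights)
  show "height TYPE('a) r s (last_eq ?ls l) = height TYPE('a) r s l"
    using fl(4) part_heights[OF mem, of "TYPE('a)"] part_heights[OF assms, of "TYPE('a)"] by simp
  show "last_eq ?ls (last_eq ?ls l) = last_eq ?ls l"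
    using first_last_eq_cong[OF fl(4)] by simp
qed

lemma ex1_block_gen:
  assumes "l \<in> {1..min r s}"
  shows "\<exists>!y :: 'a::field poly. block_gen r s l y"
proof (rule ex_ex1I)
  note last = height_last[OF assms, where 'a='a]
  show "\<exists>y :: 'a poly. block_gen r s l y"
    using ex_hits_top[OF last(1), where 'a='a] by (simp add: block_gen_def Let_def last(2))
  show "y = y'" if "block_gen r s l y" "block_gen r s l y'" for y y' :: "'a poly"
    using that hits_top_unique[OF last(1,3), of y y'] by (simp add: block_gen_def Let_def last(2))
qed

lemma block_gen_imp_pade:
  fixes y :: "'a::field poly"
  assumes l: "l \<in> {1..min r s}" and y: "block_gen r s l y"
  defines "h \<equiv> height TYPE('a) r s l" and "l' \<equiv> last_eq (heights TYPE('a) r s) l"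
  shows "\<exists>U V. pade r s l' h U V \<and> poly U (-1) = 1 \<and> [:1, 1:] ^ h * y = monom 1 r * U + V"
proof -
  have "hits_top r l' h y" "degree y + l' + h \<le> r + s"
    using y by (auto simp: block_gen_def Let_def h_def l'_def)
  moreover have "1 \<le> l'" "l' \<le> min r s" "1 \<le> h"
    using height_last(1)[OF l, where 'a='a] height_pos[OF l] by (simp_all add: l'_def h_def)
  ultimately show ?thesis by (intro hits_top_imp_pade)
qed

text \<open>A multiple of (V, -U) satisfies all conditions on the generator of the dual run, so
  uniqueness identifies its quotient by (1 + X)^h with \<open>w\<close>. Thus a single pair
  describes both generators.\<close>

lemma block_gen_dual:
  fixes y w :: "'a::field poly"
  assumes q: "[:1, 1:] ^ q = monom 1 q + (1 :: 'a poly)" and rs: "r < q" "s < q" "0 < r" "0 < s"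
    and d: "d \<in> {1..min r s}" "d' + r + s = d + q" "d' \<ge> 1"
    and y: "block_gen r s d y" and w: "block_gen (q - r) (q - s) d' w"
  defines "h \<equiv> height TYPE('a) r s d" and "k \<equiv> last_eq (heights TYPE('a) r s) d"
  shows "\<exists>U V. pade r s k h U V \<and> poly U (-1) = 1 \<and> [:1, 1:] ^ h * y = monom 1 r * U + V \<and>
      [:1, 1:] ^ h * w = smult (- ((-1) ^ r)) (monom 1 (q - r) * V - U)"
proof -
  define k' where "k' = last_eq (heights TYPE('a) (q - r) (q - s)) d'"
  have k': "k' + r + s = k + q"
    using first_last_dual(2)[OF q rs d] by (simp add: k_def k'_def)
  note d' = height_le_dual(1)[OF q rs(1,2) d]
  have h': "height TYPE('a) (q - r) (q - s) d' = h"
    using height_dual[OF q rs d] by (simp add: h_def)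
  have k'1: "k' \<ge> 1" using height_last(1)[OF d', where 'a='a] by (simp add: k'_def)
  have h1: "h \<ge> 1" using height_pos[OF d(1)] by (simp add: h_def)
  have hq: "h \<le> q" using height_le[OF d(1), where 'a='a] d(2) by (simp add: h_def)
  obtain U V where UV: "pade r s k h U V" "poly U (-1) = 1" "[:1, 1:] ^ h * y = monom 1 r * U + V"
    using block_gen_imp_pade[OF d(1) y] by (auto simp: h_def k_def)
  \<comment> \<open>\<open>c\<close> is V(-1), and c * c = 1, so scaling by \<open>c\<close>
    normalises the first component of the dual pair.\<close>
  define c :: 'a where "c = - ((-1) ^ r)"
  have c: "c \<noteq> 0" "c * c = 1" by (auto simp: c_def simp flip: power_mult_distrib)
  have dual: "pade (q - r) (q - s) k' h V (- U)"
    using rs by (intro pade_dual[OF q _ _ UV(1) hq k']) auto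
  have dvd: "[:1, 1:] ^ h dvd smult c (monom 1 (q - r) * V - U)"
    using dual c by (simp add: pade_def dvd_smult)
  then obtain w' where w': "smult c (monom 1 (q - r) * V - U) = [:1, 1:] ^ h * w'" by blast
  have eq: "monom 1 (q - r) * smult c V + smult c (- U) = smult c (monom 1 (q - r) * V - U)"
    by (simp add: smult_diff_right)
  have pade: "pade (q - r) (q - s) k' h (smult c V) (smult c (- U))"
    using dual c dvd unfolding pade_def eq by simp
  have "poly V (-1) = c" using pade_poly_eq[OF UV(1)] UV(2) h1 by (simp add: c_def)
  then have one: "poly (smult c V) (-1) = 1" using c by simp
  have top: "hits_top (q - r) k' h w'"
    using pade_imp_hits_top[OF pade one _ h1 k'1] w' eq by simp
  have "degree w' + k' + h \<le> (q - r) + (q - s)"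
  proof -
    have nz: "poly (smult c V) (-1) \<noteq> 0" using one by simp
    have "[:1, 1:] ^ h * w' \<noteq> 0" "degree ([:1, 1:] ^ h * w') + k' \<le> (q - r) + (q - s)"
      using pade_residual[OF pade _ nz] k'1 unfolding eq w' by auto
    moreover from this have "degree ([:1, 1:] ^ h * w') = degree ([:1, 1:] ^ h :: 'a poly) + degree w'"
      by (intro degree_mult_eq) auto
    ultimately show ?thesis using degree_linear_power[of h, where 'a='a] by simp
  qed
  then have "block_gen (q - r) (q - s) d' w'"
    using top by (simp add: block_gen_def Let_def h' flip: k'_def)
  then have "w' = w" using w ex1_block_gen[OF d', where 'a='a] by blast
  then have "[:1, 1:] ^ h * w = smult (- ((-1) ^ r)) (monom 1 (q - r) * V - U)"
    using w' by (simp only: c_def)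
  then show ?thesis using UV by blast
qed

section \<open>Coefficient extraction and the alternating sum\<close>

definition icoeff :: "'a::zero poly \<Rightarrow> int \<Rightarrow> 'a" where
  "icoeff p x = (if x < 0 then 0 else coeff p (nat x))"

lemma binom_eq_icoeff: "binom c x = icoeff ([:1, 1:] ^ c) x"
proof (cases "0 \<le> x \<and> x \<le> int c")
  case True
  then show ?thesis by (auto simp: binom_def icoeff_def coeff_linear_poly_power)
next
  case False
  then show ?thesis by (auto simp: binom_def icoeff_def degree_linear_power intro!: coeff_eq_0)
qed

lemma neg_one_power_mult: "(-1) ^ t * p = smult ((-1) ^ t) p" for p :: "'a::field poly"
  by (cases "even t") auto

lemma icoeff_mult:
  fixes p y :: "'a::field poly"
  assumes "degree y < k"
  shows "(\<Sum>i<k. coeff y i * icoeff p (x - int i)) = icoeff (p * y) x"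
proof (cases "x < 0")
  case True
  then show ?thesis by (auto simp: icoeff_def)
next
  case False
  then obtain N where N: "x = int N" by (metis nonneg_int_cases not_less)
  have "(\<Sum>i<k. coeff y i * icoeff p (x - int i)) = (\<Sum>i\<in>{..<k} \<inter> {..N}. coeff y i * coeff p (N - i))"
    by (rule sum.mono_neutral_cong_right) (auto simp: N icoeff_def nat_diff_distrib)
  also have "\<dots> = (\<Sum>i\<le>N. coeff y i * coeff p (N - i))"
    using assms by (intro sum.mono_neutral_left) (auto intro: coeff_eq_0)
  also have "\<dots> = coeff (y * p) N" by (simp add: coeff_mult)
  finally show ?thesis by (simp add: N icoeff_def mult.commute)
qed

lemma sum_binom_eq_icoeff:
  fixes y :: "'a::field poly"
  assumes "degree y < k"
  shows "(\<Sum>j = 1..k. coeff y (k - j) * binom c (x + int j - int k)) = icoeff ([:1, 1:] ^ c * y) x"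
proof -
  have "(\<Sum>j = 1..k. coeff y (k - j) * binom c (x + int j - int k))
      = (\<Sum>i<k. coeff y i * icoeff ([:1, 1:] ^ c) (x - int i))"
    by (rule sum.reindex_bij_witness[of _ "\<lambda>i. k - i" "\<lambda>j. k - j"])
      (auto simp: binom_eq_icoeff of_nat_diff algebra_simps)
  then show ?thesis using icoeff_mult[OF assms] by simp
qed

text \<open>The polynomial \<open>W\<close> collects all the coefficients that enter the alternating sums; the
  contributions of \<open>V\<close> cancel, and \<open>(1 + X) W\<close> telescopes to \<open>(X\<^bsup>(t+1)q\<^esup> \<plusminus> 1) U\<close>.\<close>

lemma alternating_sum:
  fixes P Q U V :: "'a::field poly"
  assumes P: "[:1, 1:] * P = monom 1 r * U + V"
    and Q: "[:1, 1:] * Q = smult (- ((-1) ^ r)) (monom 1 (q - r) * V - U)"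
    and U: "poly U (-1) = 1" "degree U + k \<le> s" and "r < q" "s < q"
    and z: "1 \<le> z" "z + s \<le> (t + 1) * q + k"
  shows "(\<Sum>i = 0..t. (-1) ^ i * (icoeff P (int i * int q + int r - int z)
           + (-1) ^ r * icoeff Q (int i * int q + int q - int z))) = (-1) ^ (z - 1)"
proof -
  define T :: "'a poly" where "T = [:1, 1:]"
  have T: "T \<noteq> 0" "degree T = 1" by (simp_all add: T_def)
  define N where "N = (t + 1) * q"
  \<comment> \<open>The two relations are aligned so that \<open>V\<close> cancels: (1 + X) B = (X^q
    + 1) U.\<close>
  define B where "B = monom 1 (q - r) * P + smult ((-1) ^ r) Q"
  define W where "W = (\<Sum>i = 0..t. (-1) ^ i * monom 1 ((t - i) * q)) * B"
  have zN: "z \<le> N" "N - z + k \<ge> s" using z U(2) by (auto simp: N_def)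
  have "T * B = monom 1 (q - r) * (T * P) + smult ((-1) ^ r) (T * Q)"
    by (simp add: B_def algebra_simps)
  also have "\<dots> = monom 1 (q - r) * (monom 1 r * U + V) - (monom 1 (q - r) * V - U)"
    using P Q by (simp add: T_def[symmetric] flip: power_mult_distrib)
  also have "\<dots> = (monom 1 q + 1) * U"
    using assms(5) by (simp add: algebra_simps mult_monom flip: mult.assoc)
  finally have TB: "T * B = (monom 1 q + 1) * U" .
  have geo: "(\<Sum>i = 0..t. (-1) ^ i * monom 1 ((t - i) * q)) * (monom 1 q + 1 :: 'a poly)
      = monom 1 ((t + 1) * q) + (-1) ^ t" for t
  proof (induction t)
    case (Suc t)
    have "(-1) ^ i * monom 1 ((Suc t - i) * q) = monom 1 q * ((-1) ^ i * monom (1 :: 'a) ((t - i) * q))"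
      if "i \<le> t" for i
      using that by (simp add: Suc_diff_le mult_monom mult.left_commute)
    then have "(\<Sum>i = 0..Suc t. (-1) ^ i * monom 1 ((Suc t - i) * q))
       = monom 1 q * (\<Sum>i = 0..t. (-1) ^ i * monom 1 ((t - i) * q)) + (-1 :: 'a poly) ^ Suc t"
      by (simp add: sum_distrib_left monom_0 mult.left_commute)
    then have "(\<Sum>i = 0..Suc t. (-1) ^ i * monom 1 ((Suc t - i) * q)) * (monom 1 q + 1 :: 'a poly)
       = monom 1 q * (monom 1 ((t + 1) * q) + (-1) ^ t) + (-1) ^ Suc t * (monom 1 q + 1)"
      by (simp only: distrib_right mult.assoc Suc.IH)
    also have "\<dots> = monom 1 q * monom 1 ((t + 1) * q) + (-1) ^ Suc t"
      by (simp add: algebra_simps)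
    finally show ?case by (simp add: mult_monom)
  qed (simp add: monom_0 add.commute)
  have "T * W = (\<Sum>i = 0..t. (-1) ^ i * monom 1 ((t - i) * q)) * (T * B)"
    by (simp add: W_def mult.left_commute)
  also have "\<dots> = (monom 1 N + (-1) ^ t) * U"
    unfolding TB mult.assoc[symmetric] geo by (simp add: N_def)
  finally have TW: "T * W = monom 1 N * U + smult ((-1) ^ t) U"
    by (simp add: distrib_right neg_one_power_mult)
  have "T dvd U - 1" using U(1) by (simp add: T_def linear_dvd_iff)
  then obtain u where u: "U = 1 + T * u" by (metis add.commute diff_add_cancel dvdE)
  \<comment> \<open>Subtracting a multiple of X^N leaves the coefficients below \<open>N\<close>
    unchanged and replaces X^N U by X^N in the product with 1 + X.\<close>
  define W' where "W' = W - monom 1 N * u"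
  have TW': "T * W' = monom 1 N + smult ((-1) ^ t) U"
    using TW by (simp add: W'_def u algebra_simps)
  have W'_coeff: "coeff W' i + (if i = 0 then 0 else coeff W' (i - 1)) = coeff (monom 1 N + smult ((-1) ^ t) U) i" for i
    unfolding TW'[symmetric] T_def by (rule coeff_linear_mult[symmetric])
  have UN: "degree U < N" using U(2) assms(6) by (auto simp: N_def)
  have W'N: "coeff W' N = 0"
  proof (cases "W' = 0")
    case False
    have "Suc (degree W') = degree (T * W')" using degree_linear_mult[OF False] by (simp add: T_def)
    also have "\<dots> \<le> N" unfolding TW' using UN
      by (intro degree_add_le) (auto simp: degree_monom_le intro: le_trans[OF degree_smult_le])
    finally show ?thesis by (intro coeff_eq_0) simp
  qed simp
  \<comment> \<open>Above deg U the only source term of the recursion is the 1 at X^N; going down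
    from the coefficient 1 of X^(N-1), the signs alternate.\<close>
  have W': "coeff W' (N - z) = (-1) ^ (z - 1)" if "1 \<le> z" "z \<le> N" "N - z + k \<ge> s" for z
    using that
  proof (induction z rule: nat_induct_at_least)
    case base
    then show ?case using W'_coeff[of N] W'N UN by (simp add: coeff_eq_0)
  next
    case (Suc z)
    have "coeff W' (N - z) + coeff W' (N - Suc z) = 0"
    proof -
      have "N - z \<noteq> 0" "N - z \<noteq> N" "degree U < N - z" using Suc.prems Suc.hyps U(2) by auto
      then show ?thesis using W'_coeff[of "N - z"] by (simp add: coeff_eq_0)
    qed
    moreover have "coeff W' (N - z) = (-1) ^ (z - 1)" using Suc by simp
    ultimately show ?case using Suc.hyps by (cases z) (auto simp: eq_neg_iff_add_eq_0 add.commute)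
  qed
  have "coeff W (N - z) = coeff W' (N - z)"
    using z(1) zN(1) by (simp add: W'_def coeff_monom_mult)
  moreover have "coeff W (N - z) = (\<Sum>i = 0..t. (-1) ^ i * (icoeff P (int i * int q + int r - int z)
           + (-1) ^ r * icoeff Q (int i * int q + int q - int z)))"
  proof -
    have "coeff (monom 1 ((t - i) * q) * B) (N - z) = icoeff P (int i * int q + int r - int z)
           + (-1) ^ r * icoeff Q (int i * int q + int q - int z)" if "i \<le> t" for i
    proof -
      have shift: "coeff (monom 1 a * p) n = icoeff p (int n - int a)" for a n and p :: "'a poly"
        by (auto simp: coeff_monom_mult icoeff_def nat_diff_distrib)
      have "monom 1 ((t - i) * q) * B =
          monom 1 ((t - i) * q + (q - r)) * P + smult ((-1) ^ r) (monom 1 ((t - i) * q) * Q)"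
        by (simp add: B_def algebra_simps mult_monom flip: mult.assoc)
      moreover have N_eq: "N = i * q + (t - i) * q + q"
        using that by (simp add: N_def flip: distrib_right)
      moreover have "int (N - z) - int ((t - i) * q + (q - r)) = int i * int q + int r - int z"
        "int (N - z) - int ((t - i) * q) = int i * int q + int q - int z"
        using zN assms(5) by (simp_all add: N_eq of_nat_diff)
      ultimately show ?thesis by (simp only: coeff_add coeff_smult shift)
    qed
    then show ?thesis
      by (simp add: W_def sum_distrib_right coeff_sum mult.assoc neg_one_power_mult)
  qed
  ultimately show ?thesis using W'[OF z(1) zN] by simp
qed

section \<open>Kronecker products\<close>

lemma sum_lessThan_mult: "(\<Sum>x<r * s. f x) = (\<Sum>i<r. \<Sum>j<s. f (i * s + j))"
  for f :: "nat \<Rightarrow> 'a::comm_monoid_add"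
proof (induction r)
  case (Suc r)
  have "(\<Sum>x<r * s + n. f x) = (\<Sum>x<r * s. f x) + (\<Sum>j<n. f (r * s + j))" for n
    by (induction n) (simp_all add: add.assoc)
  from this[of s] show ?case using Suc by (simp add: add.commute)
qed simp

lemma pair_index: "i < r \<Longrightarrow> j < s \<Longrightarrow> i * s + j < r * s" for i :: nat
  using mult_le_mono1[of "Suc i" r s] by simp

lemma pair_index_div: "j < s \<Longrightarrow> (i * s + j) div s = i" "j < s \<Longrightarrow> (i * s + j) mod s = j" for i :: nat
  by auto

lemma div_less_of_prod: "x < r * s \<Longrightarrow> x div s < r \<and> x mod s < s" for x :: nat
  by (metis less_mult_imp_div_less mod_less_divisor mult_0_right not_less_zero neq0_conv)

lemma kron_mat_carrier:
  "A \<in> carrier_mat r r \<Longrightarrow> B \<in> carrier_mat s s \<Longrightarrow> kron_mat A B \<in> carrier_mat (r * s) (r * s)"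
  by (auto simp: kron_mat_def)

lemma kron_mat_index:
  assumes "A \<in> carrier_mat r r" "B \<in> carrier_mat s s" "x < r * s" "y < r * s"
  shows "kron_mat A B $$ (x, y) = A $$ (x div s, y div s) * B $$ (x mod s, y mod s)"
  using assms by (auto simp: kron_mat_def)

lemma kron_mat_mult:
  fixes A B :: "'a::field mat"
  assumes "A \<in> carrier_mat r r" "B \<in> carrier_mat s s" "A' \<in> carrier_mat r r" "B' \<in> carrier_mat s s"
  shows "kron_mat A B * kron_mat A' B' = kron_mat (A * A') (B * B')"
proof (rule eq_matI)
  note carr = kron_mat_carrier[OF assms(1,2)] kron_mat_carrier[OF assms(3,4)]
    kron_mat_carrier[OF mult_carrier_mat[OF assms(1,3)] mult_carrier_mat[OF assms(2,4)]]
  fix x y assume "x < dim_row (kron_mat (A * A') (B * B'))" "y < dim_col (kron_mat (A * A') (B * B'))"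
  then have xy: "x < r * s" "y < r * s" using carr by auto
  note dm = div_less_of_prod[OF xy(1)] div_less_of_prod[OF xy(2)]
  have "(kron_mat A B * kron_mat A' B') $$ (x, y) = (\<Sum>w<r * s. kron_mat A B $$ (x, w) * kron_mat A' B' $$ (w, y))"
    using carr xy by (simp add: scalar_prod_def lessThan_atLeast0)
  also have "\<dots> = (\<Sum>i<r. \<Sum>j<s. (A $$ (x div s, i) * A' $$ (i, y div s)) * (B $$ (x mod s, j) * B' $$ (j, y mod s)))"
    unfolding sum_lessThan_mult
    by (intro sum.cong refl) (simp add: kron_mat_index[OF assms(1,2)] kron_mat_index[OF assms(3,4)]
        xy pair_index pair_index_div mult_ac)
  also have "\<dots> = (A * A') $$ (x div s, y div s) * (B * B') $$ (x mod s, y mod s)"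
    using dm assms by (simp add: sum_product scalar_prod_def lessThan_atLeast0)
  finally show "(kron_mat A B * kron_mat A' B') $$ (x, y) = kron_mat (A * A') (B * B') $$ (x, y)"
    using kron_mat_index[OF mult_carrier_mat[OF assms(1,3)] mult_carrier_mat[OF assms(2,4)] xy] by simp
qed (use assms in \<open>auto simp: kron_mat_def\<close>)

lemma kron_mat_one: "kron_mat (1\<^sub>m r) (1\<^sub>m s) = (1\<^sub>m (r * s) :: 'a::field mat)"
proof (rule eq_matI)
  fix x y assume "x < dim_row (1\<^sub>m (r * s) :: 'a mat)" "y < dim_col (1\<^sub>m (r * s) :: 'a mat)"
  then have xy: "x < r * s" "y < r * s" by auto
  moreover have "x = y \<longleftrightarrow> x div s = y div s \<and> x mod s = y mod s" by (metis div_mult_mod_eq)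
  ultimately show "kron_mat (1\<^sub>m r) (1\<^sub>m s) $$ (x, y) = (1\<^sub>m (r * s) :: 'a mat) $$ (x, y)"
    using div_less_of_prod[of x r s] div_less_of_prod[of y r s]
    by (subst kron_mat_index[of _ r _ s]) auto
qed (auto simp: kron_mat_def)

lemma kron_mat_pow:
  fixes A B :: "'a::field mat"
  assumes "A \<in> carrier_mat r r" "B \<in> carrier_mat s s"
  shows "kron_mat (A ^\<^sub>m k) (B ^\<^sub>m k) = kron_mat A B ^\<^sub>m k"
proof (induction k)
  case 0
  then show ?case using assms kron_mat_one[of r s] kron_mat_carrier[OF assms] by auto
next
  case (Suc k)
  then show ?case
    using kron_mat_mult[OF pow_carrier_mat[OF assms(1)] pow_carrier_mat[OF assms(2)] assms, of k k] by simp
qed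

lemma kron_mat_mult_vec:
  fixes A B :: "'a::field mat"
  assumes "A \<in> carrier_mat r r" "B \<in> carrier_mat s s" "u \<in> carrier_vec (r * s)" "i < r" "j < s"
  shows "(kron_mat A B *\<^sub>v u) $ (i * s + j)
    = (\<Sum>i'<r. A $$ (i, i') * (B *\<^sub>v vec s (\<lambda>j'. u $ (i' * s + j'))) $ j)"
proof -
  have "(kron_mat A B *\<^sub>v u) $ (i * s + j) = (\<Sum>w<r * s. kron_mat A B $$ (i * s + j, w) * u $ w)"
    using kron_mat_carrier[OF assms(1,2)] assms pair_index[OF assms(4,5)]
    by (simp add: scalar_prod_def lessThan_atLeast0)
  also have "\<dots> = (\<Sum>i'<r. \<Sum>j'<s. A $$ (i, i') * (B $$ (j, j') * u $ (i' * s + j')))"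
    unfolding sum_lessThan_mult
    by (intro sum.cong refl)
      (simp add: kron_mat_index[OF assms(1,2)] assms(4,5) pair_index pair_index_div mult_ac)
  also have "\<dots> = (\<Sum>i'<r. A $$ (i, i') * (B *\<^sub>v vec s (\<lambda>j'. u $ (i' * s + j'))) $ j)"
    using assms by (simp add: scalar_prod_def lessThan_atLeast0 sum_distrib_left)
  finally show ?thesis .
qed

text \<open>With \<open>W i\<close> the matrix of \<open>g\<^bsup>N-i\<^esup>\<close>, this is the vector with coordinates \<open>c i j\<close> (one-based)
  in the basis \<open>v\<^bsub>i,j\<^esub>\<close>.\<close>

definition twisted_vec :: "(nat \<Rightarrow> 'a::field mat) \<Rightarrow> nat \<Rightarrow> nat \<Rightarrow> (nat \<Rightarrow> nat \<Rightarrow> 'a) \<Rightarrow> 'a vec" where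
  "twisted_vec W r s c =
     vec (r * s) (\<lambda>x. (W (x div s + 1) *\<^sub>v vec s (\<lambda>j. c (x div s + 1) (j + 1))) $ (x mod s))"

lemma twisted_vec_carrier: "twisted_vec W r s c \<in> carrier_vec (r * s)"
  by (simp add: twisted_vec_def)

lemma twisted_vec_index:
  assumes "i < r" "j < s"
  shows "twisted_vec W r s c $ (i * s + j) = (W (i + 1) *\<^sub>v vec s (\<lambda>j. c (i + 1) (j + 1))) $ j"
  using pair_index[OF assms] assms by (simp add: twisted_vec_def pair_index_div)

lemma eq_vec_prodI:
  fixes u v :: "'a vec"
  assumes "u \<in> carrier_vec (r * s)" "v \<in> carrier_vec (r * s)"
    and "\<And>i j. i < r \<Longrightarrow> j < s \<Longrightarrow> u $ (i * s + j) = v $ (i * s + j)"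
  shows "u = v"
proof (rule eq_vecI)
  fix x assume "x < dim_vec v"
  then have "x < r * s" using assms(2) by auto
  then show "u $ x = v $ x"
    using assms(3)[of "x div s" "x mod s"] div_less_of_prod[of x r s] by (metis div_mult_mod_eq)
qed (use assms in auto)

lemma twisted_vec_cong:
  "(\<And>i j. i \<in> {1..r} \<Longrightarrow> j \<in> {1..s} \<Longrightarrow> c i j = c' i j) \<Longrightarrow> twisted_vec W r s c = twisted_vec W r s c'"
  by (rule eq_vec_prodI[OF twisted_vec_carrier twisted_vec_carrier])
    (auto simp: twisted_vec_index intro!: arg_cong[of _ _ "\<lambda>v. (_ *\<^sub>v v) $ _"])

context
  fixes W :: "nat \<Rightarrow> 'a::field mat" and s :: nat
  assumes W: "\<And>i. W i \<in> carrier_mat s s"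
begin

lemma twisted_vec_sum_index:
  assumes "finite I" "x < r * s"
  shows "twisted_vec W r s (\<lambda>i j. \<Sum>d\<in>I. f d * c d i j) $ x = (\<Sum>d\<in>I. f d * twisted_vec W r s (c d) $ x)"
proof -
  note dm = div_less_of_prod[OF assms(2)]
  have "twisted_vec W r s (\<lambda>i j. \<Sum>d\<in>I. f d * c d i j) $ x
     = (\<Sum>j<s. W (x div s + 1) $$ (x mod s, j) * (\<Sum>d\<in>I. f d * c d (x div s + 1) (j + 1)))"
    using W[of "x div s + 1"] dm assms(2) by (simp add: twisted_vec_def scalar_prod_def lessThan_atLeast0)
  also have "\<dots> = (\<Sum>d\<in>I. \<Sum>j<s. f d * (W (x div s + 1) $$ (x mod s, j) * c d (x div s + 1) (j + 1)))"
    by (subst sum.swap) (simp add: sum_distrib_left mult.left_commute)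
  also have "\<dots> = (\<Sum>d\<in>I. f d * twisted_vec W r s (c d) $ x)"
    using W[of "x div s + 1"] dm assms(2)
    by (simp add: twisted_vec_def scalar_prod_def lessThan_atLeast0 sum_distrib_left)
  finally show ?thesis .
qed

lemma twisted_vec_inject:
  assumes inv: "\<And>i. W' i \<in> carrier_mat s s \<and> W' i * W i = 1\<^sub>m s"
    and eq: "twisted_vec W r s c = twisted_vec W r s c'" and ij: "i \<in> {1..r}" "j \<in> {1..s}"
  shows "c i j = c' i j"
proof -
  define C where "C c = vec s (\<lambda>j. c i (j + 1))" for c :: "nat \<Rightarrow> nat \<Rightarrow> 'a"
  have C: "C c \<in> carrier_vec s" for c by (simp add: C_def)
  have i: "i - 1 < r" "i - 1 + 1 = i" and j: "j - 1 < s" "j - 1 + 1 = j" using ij by auto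
  have "W i *\<^sub>v C c = W i *\<^sub>v C c'"
  proof (rule eq_vecI)
    fix b assume "b < dim_vec (W i *\<^sub>v C c')"
    then have "b < s" using W[of i] by simp
    then show "(W i *\<^sub>v C c) $ b = (W i *\<^sub>v C c') $ b"
      using twisted_vec_index[OF i(1), of b s W c] twisted_vec_index[OF i(1), of b s W c'] eq i(2)
      by (simp add: C_def)
  qed simp
  then have "W' i *\<^sub>v (W i *\<^sub>v C c) = W' i *\<^sub>v (W i *\<^sub>v C c')" by simp
  moreover have "W' i *\<^sub>v (W i *\<^sub>v C c) = C c" for c
    using assoc_mult_mat_vec[of "W' i" s s "W i" s "C c"] inv[of i] W[of i] C by simp
  ultimately have "C c = C c'" by simp
  then have "C c $ (j - 1) = C c' $ (j - 1)" by simp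
  then show ?thesis using j by (simp add: C_def)
qed

end

lemma mult_mat_vec_index_sum:
  assumes "A \<in> carrier_mat n m" "v \<in> carrier_vec m" "x < n"
  shows "(A *\<^sub>v v) $ x = (\<Sum>y<m. A $$ (x, y) * v $ y)"
  using assms by (simp add: scalar_prod_def lessThan_atLeast0)

lemma jordan_block_mult_vec:
  fixes v :: "'a::field vec"
  assumes "v \<in> carrier_vec s" "j < s"
  shows "(jordan_block s 1 *\<^sub>v v) $ j = v $ j + (if j + 1 < s then v $ (j + 1) else 0)"
proof -
  have "(jordan_block s 1 *\<^sub>v v) $ j = (\<Sum>i<s. jordan_block s 1 $$ (j, i) * v $ i)"
    using assms by (intro mult_mat_vec_index_sum) auto
  also have "\<dots> = (\<Sum>i<s. (if j = i then v $ i else 0) + (if Suc j = i then v $ i else 0))"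
    using assms by (intro sum.cong refl) auto
  finally show ?thesis using assms by (simp add: sum.distrib)
qed

text \<open>Without the twist, g \<otimes> g - 1 would produce a third term v_{i-1} \<otimes>
  v_{j-1}. The hypothesis \<open>step\<close> absorbs it: applying g to the second factor turns the
  twist belonging to v_i into the one belonging to v_{i-1}. On coordinates the index shifts go
  upwards.\<close>

lemma kron_jordan_twisted_vec:
  fixes W :: "nat \<Rightarrow> 'a::field mat"
  assumes W: "\<And>i. W i \<in> carrier_mat s s"
    and step: "\<And>i. jordan_block s 1 * W (Suc i) = W i" and comm: "\<And>i. jordan_block s 1 * W i = W i * jordan_block s 1"
  shows "(kron_mat (jordan_block r 1) (jordan_block s 1) - 1\<^sub>m (r * s)) *\<^sub>v twisted_vec W r s c
    = twisted_vec W r s (\<lambda>i j. (if i < r then c (i + 1) j else 0) + (if j < s then c i (j + 1) else 0))"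
    (is "(?K - _) *\<^sub>v ?E = twisted_vec W r s ?c'")
proof (rule eq_vec_prodI)
  have K: "?K \<in> carrier_mat (r * s) (r * s)" by (intro kron_mat_carrier) auto
  have E: "?E \<in> carrier_vec (r * s)" by (rule twisted_vec_carrier)
  show "(?K - 1\<^sub>m (r * s)) *\<^sub>v ?E \<in> carrier_vec (r * s)"
    using E by (intro mult_mat_vec_carrier minus_carrier_mat) auto
  show "twisted_vec W r s ?c' \<in> carrier_vec (r * s)" by (rule twisted_vec_carrier)
  fix i j assume ij: "i < r" "j < s"
  note x = pair_index[OF ij]
  define C where "C i = vec s (\<lambda>j. c (i + 1) (j + 1))" for i
  have C: "C i \<in> carrier_vec s" for i by (simp add: C_def)
  have row: "vec s (\<lambda>j'. ?E $ (i' * s + j')) = W (i' + 1) *\<^sub>v C i'" if "i' < r" for i'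
    by (rule eq_vecI) (use that W[of "i' + 1"] in \<open>auto simp: twisted_vec_index C_def\<close>)
  have "((?K - 1\<^sub>m (r * s)) *\<^sub>v ?E) $ (i * s + j) = (?K *\<^sub>v ?E) $ (i * s + j) - ?E $ (i * s + j)"
    using K E x by (simp add: minus_mult_distrib_mat_vec[OF K one_carrier_mat E])
  also have "(?K *\<^sub>v ?E) $ (i * s + j)
      = (\<Sum>i'<r. jordan_block r 1 $$ (i, i') * (jordan_block s 1 *\<^sub>v (W (i' + 1) *\<^sub>v C i')) $ j)"
    by (subst kron_mat_mult_vec[OF _ _ E ij]) (auto simp: row)
  also have "\<dots> = (\<Sum>i'<r. (if i = i' then (jordan_block s 1 *\<^sub>v (W (i' + 1) *\<^sub>v C i')) $ j else 0)
      + (if Suc i = i' then (jordan_block s 1 *\<^sub>v (W (i' + 1) *\<^sub>v C i')) $ j else 0))"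
    using ij by (intro sum.cong) auto
  also have "\<dots> = (jordan_block s 1 *\<^sub>v (W (i + 1) *\<^sub>v C i)) $ j
      + (if i + 1 < r then (jordan_block s 1 *\<^sub>v (W (i + 2) *\<^sub>v C (i + 1))) $ j else 0)"
    using ij by (simp add: sum.distrib)
  also have "jordan_block s 1 *\<^sub>v (W (i + 1) *\<^sub>v C i) = W (i + 1) *\<^sub>v (jordan_block s 1 *\<^sub>v C i)"
    using C W[of "i + 1"] comm[of "i + 1"] by (simp flip: assoc_mult_mat_vec[of _ s s _ s])
  also have "jordan_block s 1 *\<^sub>v (W (i + 2) *\<^sub>v C (i + 1)) = W (i + 1) *\<^sub>v C (i + 1)"
    using C W[of "i + 2"] step[of "i + 1"] by (simp flip: assoc_mult_mat_vec[of _ s s _ s])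
  also have "?E $ (i * s + j) = (W (i + 1) *\<^sub>v C i) $ j"
    using ij by (simp add: twisted_vec_index C_def)
  finally have "((?K - 1\<^sub>m (r * s)) *\<^sub>v ?E) $ (i * s + j) =
      (W (i + 1) *\<^sub>v (jordan_block s 1 *\<^sub>v C i)) $ j
      + (if i + 1 < r then (W (i + 1) *\<^sub>v C (i + 1)) $ j else 0) - (W (i + 1) *\<^sub>v C i) $ j" .
  also have "\<dots> = (\<Sum>b<s. W (i + 1) $$ (j, b) * ((jordan_block s 1 *\<^sub>v C i) $ b
      + (if i + 1 < r then C (i + 1) $ b else 0) - C i $ b))"
    using W[of "i + 1"] ij C[of i] C[of "i + 1"]
    by (simp add: scalar_prod_def lessThan_atLeast0 sum.distrib sum_subtractf algebra_simps)
  also have "\<dots> = (\<Sum>b<s. W (i + 1) $$ (j, b) * ?c' (i + 1) (b + 1))"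
  proof (intro sum.cong refl)
    fix b assume "b \<in> {..<s}"
    then have b: "b < s" by simp
    show "W (i + 1) $$ (j, b) * ((jordan_block s 1 *\<^sub>v C i) $ b + (if i + 1 < r then C (i + 1) $ b else 0)
        - C i $ b) = W (i + 1) $$ (j, b) * ?c' (i + 1) (b + 1)"
      unfolding jordan_block_mult_vec[OF C b] using b by (simp add: C_def)
  qed
  also have "\<dots> = twisted_vec W r s ?c' $ (i * s + j)"
    using W[of "i + 1"] ij by (simp add: twisted_vec_index scalar_prod_def lessThan_atLeast0 cong: if_cong)
  finally show "((?K - 1\<^sub>m (r * s)) *\<^sub>v ?E) $ (i * s + j) = twisted_vec W r s ?c' $ (i * s + j)" .
qed

section \<open>Bases of Jordan strings\<close>

lemma pow_mat_mult_vec_carrier: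
  assumes "M \<in> carrier_mat n n" "u \<in> carrier_vec n"
  shows "M ^\<^sub>m k *\<^sub>v u \<in> carrier_vec n"
  using assms by (rule mult_mat_vec_carrier[OF pow_carrier_mat])

lemma pow_mat_mult_vec_Suc:
  assumes "M \<in> carrier_mat n n" "u \<in> carrier_vec n"
  shows "M ^\<^sub>m Suc k *\<^sub>v u = M *\<^sub>v (M ^\<^sub>m k *\<^sub>v u)"
  using assms(2)
proof (induction k arbitrary: u)
  case 0
  then show ?case using assms(1) by simp
next
  case (Suc k)
  have pow: "M ^\<^sub>m Suc j *\<^sub>v u = M ^\<^sub>m j *\<^sub>v (M *\<^sub>v u)" for j
    using assms(1) Suc.prems by (simp add: assoc_mult_mat_vec[of _ n n _ n])
  have "M ^\<^sub>m Suc (Suc k) *\<^sub>v u = M ^\<^sub>m Suc k *\<^sub>v (M *\<^sub>v u)" by (rule pow)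
  also have "\<dots> = M *\<^sub>v (M ^\<^sub>m k *\<^sub>v (M *\<^sub>v u))"
    by (rule Suc.IH[OF mult_mat_vec_carrier[OF assms(1) Suc.prems]])
  finally show ?case by (simp only: pow)
qed

lemma pow_mat_mult_vec_add:
  assumes "M \<in> carrier_mat n n" "u \<in> carrier_vec n"
  shows "M ^\<^sub>m j *\<^sub>v (M ^\<^sub>m k *\<^sub>v u) = M ^\<^sub>m (j + k) *\<^sub>v u"
proof (induction j)
  case 0
  have "M ^\<^sub>m k *\<^sub>v u \<in> carrier_vec n"
    using assms by (rule pow_mat_mult_vec_carrier)
  then show ?case using assms by simp
next
  case (Suc j)
  have v: "M ^\<^sub>m k *\<^sub>v u \<in> carrier_vec n"
    using assms by (rule pow_mat_mult_vec_carrier)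
  show ?case
    using pow_mat_mult_vec_Suc[OF assms(1) v, of j] pow_mat_mult_vec_Suc[OF assms, of "j + k"] Suc
    by simp
qed

lemma pow_mat_mult_vec_zero:
  assumes "M \<in> carrier_mat n n" "u \<in> carrier_vec n" "M ^\<^sub>m l *\<^sub>v u = 0\<^sub>v n" "l \<le> j"
  shows "M ^\<^sub>m j *\<^sub>v u = 0\<^sub>v n"
proof -
  have "M ^\<^sub>m (j - l) *\<^sub>v 0\<^sub>v n = 0\<^sub>v n"
    using pow_carrier_mat[OF assms(1), of "j - l"]
    by (intro eq_vecI) (auto simp: scalar_prod_def)
  then show ?thesis
    using pow_mat_mult_vec_add[OF assms(1,2), of "j - l" l] assms(3,4) by simp
qed

text \<open>Decreasing powers put the end of the string first, as the upper triangular
  \<open>jordan_block\<close> requires.\<close>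

definition jordan_string :: "'a::field mat \<Rightarrow> nat \<Rightarrow> 'a vec \<Rightarrow> 'a vec list" where
  "jordan_string M l u = map (\<lambda>i. M ^\<^sub>m (l - 1 - i) *\<^sub>v u) [0..<l]"

lemma length_jordan_string: "length (jordan_string M l u) = l"
  by (simp add: jordan_string_def)

lemma jordan_string_block:
  fixes K :: "'a::field mat"
  assumes K: "K \<in> carrier_mat n n" and u: "u \<in> carrier_vec n"
  defines "M \<equiv> K - 1\<^sub>m n"
  assumes nil: "M ^\<^sub>m l *\<^sub>v u = 0\<^sub>v n"
  shows "K * mat_of_cols n (jordan_string M l u) = mat_of_cols n (jordan_string M l u) * jordan_block l 1"
proof (rule eq_matI)
  let ?b = "\<lambda>i. M ^\<^sub>m (l - 1 - i) *\<^sub>v u"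
  have M: "M \<in> carrier_mat n n" unfolding M_def by (rule minus_carrier_mat) simp
  have b: "?b i \<in> carrier_vec n" for i
    using M u by (rule pow_mat_mult_vec_carrier)
  have dims: "dim_col (mat_of_cols n (jordan_string M l u)) = l" by (simp add: length_jordan_string)
  fix x i assume "x < dim_row (mat_of_cols n (jordan_string M l u) * jordan_block l 1)"
    "i < dim_col (mat_of_cols n (jordan_string M l u) * (jordan_block l 1 :: 'a mat))"
  then have xi: "x < n" "i < l" by (auto simp: length_jordan_string)
  have col: "col (mat_of_cols n (jordan_string M l u)) i = ?b i"
    using xi b by (subst col_mat_of_cols) (auto simp: jordan_string_def)
  have "(K * mat_of_cols n (jordan_string M l u)) $$ (x, i) = (K *\<^sub>v ?b i) $ x"
    using K xi dims by (simp add: col)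
  also have "\<dots> = ?b i $ x + (M *\<^sub>v ?b i) $ x"
    using minus_mult_distrib_mat_vec[OF K one_carrier_mat b, of i] K b[of i] xi by (simp add: M_def)
  also have "M *\<^sub>v ?b i = M ^\<^sub>m (l - i) *\<^sub>v u"
    using pow_mat_mult_vec_Suc[OF M u, of "l - 1 - i"] xi by (simp add: Suc_diff_Suc)
  also have "?b i $ x + (M ^\<^sub>m (l - i) *\<^sub>v u) $ x = ?b i $ x + (if i = 0 then 0 else ?b (i - 1) $ x)"
    using nil xi by (cases i) auto
  also have "\<dots> = (\<Sum>j<l. (if j = i then ?b j $ x else 0) + (if Suc j = i then ?b j $ x else 0))"
  proof -
    have "(\<Sum>j<l. if Suc j = i then ?b j $ x else 0) = (if i = 0 then 0 else ?b (i - 1) $ x)"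
      using xi by (cases i) auto
    then show ?thesis using xi by (simp add: sum.distrib)
  qed
  also have "\<dots> = (\<Sum>j<l. ?b j $ x * jordan_block l 1 $$ (j, i))"
    using xi by (intro sum.cong) auto
  also have "\<dots> = (mat_of_cols n (jordan_string M l u) * jordan_block l 1) $$ (x, i)"
    using xi by (simp add: scalar_prod_def lessThan_atLeast0 length_jordan_string mat_of_cols_index)
      (simp add: jordan_string_def)
  finally show "(K * mat_of_cols n (jordan_string M l u)) $$ (x, i)
      = (mat_of_cols n (jordan_string M l u) * jordan_block l 1) $$ (x, i)" .
qed (use K in \<open>auto simp: length_jordan_string\<close>)

lemma mat_of_cols_append:
  "mat_of_cols n (xs @ ys) = four_block_mat (mat_of_cols n xs) (mat_of_cols n ys)
     (0\<^sub>m 0 (length xs)) (0\<^sub>m 0 (length ys))"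
  by (rule eq_matI) (auto simp: mat_of_cols_index nth_append)

lemma jordan_strings_intertwine:
  fixes K :: "'a::field mat"
  assumes K: "K \<in> carrier_mat n n"
  defines "M \<equiv> K - 1\<^sub>m n"
  assumes bs: "\<And>l u. (l, u) \<in> set bs \<Longrightarrow> u \<in> carrier_vec n \<and> M ^\<^sub>m l *\<^sub>v u = 0\<^sub>v n"
  defines "cs \<equiv> concat (map (\<lambda>(l, u). jordan_string M l u) bs)"
    and "D \<equiv> diag_block_mat (map (\<lambda>(l, u). jordan_block l 1) bs)"
  shows "length cs = sum_list (map fst bs) \<and> D \<in> carrier_mat (length cs) (length cs) \<and>
    K * mat_of_cols n cs = mat_of_cols n cs * D"
  using bs unfolding cs_def D_def
proof (induction bs)
  case Nil
  then show ?case using K by (auto intro!: eq_matI)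
next
  case (Cons b bs)
  obtain l u where b: "b = (l, u)" by (cases b)
  let ?x = "jordan_string M l u" and ?y = "concat (map (\<lambda>(l, u). jordan_string M l u) bs)"
  let ?J = "jordan_block l (1 :: 'a)" and ?D = "diag_block_mat (map (\<lambda>(l, u). jordan_block l (1 :: 'a)) bs)"
  have IH: "length ?y = sum_list (map fst bs)" "?D \<in> carrier_mat (length ?y) (length ?y)"
    "K * mat_of_cols n ?y = mat_of_cols n ?y * ?D"
    using Cons by auto
  have lx: "length ?x = l" by (rule length_jordan_string)
  have x: "K * mat_of_cols n ?x = mat_of_cols n ?x * ?J"
    using Cons.prems K by (auto simp: b M_def intro!: jordan_string_block)
  have D: "diag_block_mat (map (\<lambda>(l, u). jordan_block l 1) (b # bs))
      = four_block_mat ?J (0\<^sub>m l (length ?y)) (0\<^sub>m (length ?y) l) ?D"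
    using IH(2) by (simp add: b Let_def)
  have cs: "mat_of_cols n (?x @ ?y)
      = four_block_mat (mat_of_cols n ?x) (mat_of_cols n ?y) (0\<^sub>m 0 l) (0\<^sub>m 0 (length ?y))"
    by (simp only: mat_of_cols_append lx)
  have cx: "mat_of_cols n ?x \<in> carrier_mat n l" using lx by auto
  have cy: "mat_of_cols n ?y \<in> carrier_mat n (length ?y)" by auto
  \<comment> \<open>Blocks without rows or columns turn the juxtaposition of columns into an
    instance of the four-block product.\<close>
  have K4: "K = four_block_mat K (0\<^sub>m n 0) (0\<^sub>m 0 n) (0\<^sub>m 0 0)"
    using K by (intro eq_matI) auto
  have "K * mat_of_cols n (?x @ ?y)
      = four_block_mat (K * mat_of_cols n ?x) (K * mat_of_cols n ?y) (0\<^sub>m 0 l) (0\<^sub>m 0 (length ?y))"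
    unfolding cs by (subst K4, subst mult_four_block_mat[OF K _ _ _ cx cy]) (use K cx cy in auto)
  moreover have "mat_of_cols n (?x @ ?y) * four_block_mat ?J (0\<^sub>m l (length ?y)) (0\<^sub>m (length ?y) l) ?D
      = four_block_mat (mat_of_cols n ?x * ?J) (mat_of_cols n ?y * ?D) (0\<^sub>m 0 l) (0\<^sub>m 0 (length ?y))"
    unfolding cs by (subst mult_four_block_mat[OF cx cy _ _ _ _ _ IH(2)]) (use cx cy IH(2) in auto)
  moreover have "four_block_mat ?J (0\<^sub>m l (length ?y)) (0\<^sub>m (length ?y) l) ?D
      \<in> carrier_mat (l + length ?y) (l + length ?y)"
    using IH(2) by (intro four_block_carrier_mat) auto
  ultimately show ?case
    using IH(1,3) x lx unfolding D by (simp add: b)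
qed

text \<open>Column offsets are hidden in an existential map; that it reaches every column is what
  traces a nonzero coefficient back to a position in some string.\<close>

lemma sum_concat:
  "\<exists>\<phi>. (\<forall>F w. (\<Sum>c<length (concat xss). F (concat xss ! c) * w c)
            = (\<Sum>d<length xss. \<Sum>i<length (xss ! d). F (xss ! d ! i) * w (\<phi> d i) :: 'a::semiring_0)) \<and>
       (\<forall>c<length (concat xss). \<exists>d<length xss. \<exists>i<length (xss ! d). c = \<phi> d i)"
proof (induction xss)
  case (Cons xs xss)
  then obtain \<phi> where \<phi>: "\<And>F w. (\<Sum>c<length (concat xss). F (concat xss ! c) * w c)
            = (\<Sum>d<length xss. \<Sum>i<length (xss ! d). F (xss ! d ! i) * w (\<phi> d i) :: 'a)"
     "\<And>c. c < length (concat xss) \<Longrightarrow> \<exists>d<length xss. \<exists>i<length (xss ! d). c = \<phi> d i" by auto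
  define \<psi> where "\<psi> d i = (case d of 0 \<Rightarrow> i | Suc d \<Rightarrow> length xs + \<phi> d i)" for d i
  have split: "(\<Sum>i<a + b. f i) = (\<Sum>i<a. f i) + (\<Sum>i<b. f (a + i))" for a b and f :: "nat \<Rightarrow> 'a"
    by (induction b) (simp_all add: add.assoc)
  have "(\<Sum>c<length (concat (xs # xss)). F (concat (xs # xss) ! c) * w c)
      = (\<Sum>d<length (xs # xss). \<Sum>i<length ((xs # xss) ! d). F ((xs # xss) ! d ! i) * w (\<psi> d i))"
    for F and w :: "nat \<Rightarrow> 'a"
  proof -
    have "(\<Sum>c<length (concat (xs # xss)). F (concat (xs # xss) ! c) * w c)
      = (\<Sum>c<length xs. F (xs ! c) * w c) + (\<Sum>c<length (concat xss). F (concat xss ! c) * w (length xs + c))"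
      by (simp only: concat.simps length_append split) (simp add: nth_append)
    also have "\<dots> = (\<Sum>i<length xs. F (xs ! i) * w (\<psi> 0 i))
        + (\<Sum>d<length xss. \<Sum>i<length (xss ! d). F (xss ! d ! i) * w (\<psi> (Suc d) i))"
      unfolding \<phi>(1)[of F "\<lambda>c. w (length xs + c)"] by (simp add: \<psi>_def)
    finally show ?thesis by (simp only: list.size sum.lessThan_Suc_shift nth_Cons_0 nth_Cons_Suc add_0_right add_Suc_right One_nat_def)
  qed
  moreover have "\<exists>d<length (xs # xss). \<exists>i<length ((xs # xss) ! d). c = \<psi> d i"
    if "c < length (concat (xs # xss))" for c
  proof (cases "c < length xs")
    case True
    then have "(0::nat) < length (xs # xss)" "c < length ((xs # xss) ! 0)" "c = \<psi> 0 c"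
      by (simp_all add: \<psi>_def)
    then show ?thesis by blast
  next
    case False
    then have lt: "c - length xs < length (concat xss)" using that by simp
    obtain d i where "d < length xss" "i < length (xss ! d)" "c - length xs = \<phi> d i"
      using \<phi>(2)[OF lt] by blast
    then have "Suc d < length (xs # xss)" "i < length ((xs # xss) ! Suc d)" "c = \<psi> (Suc d) i"
      using False by (simp_all add: \<psi>_def)
    then show ?thesis by blast
  qed
  ultimately show ?case by blast
qed simp

text \<open>Applying a power of \<open>K - 1\<close> that kills all but the last surviving layer of a linear
  relation reduces the independence of the strings to that of their ends.\<close>

lemma jordan_strings_basis:
  fixes K :: "'a::field mat" and ls :: "nat list" and u :: "nat \<Rightarrow> 'a vec"
  assumes K: "K \<in> carrier_mat n n"
  defines "M \<equiv> K - 1\<^sub>m n"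
  assumes u: "\<And>d. d < length ls \<Longrightarrow> u d \<in> carrier_vec n"
    and nil: "\<And>d. d < length ls \<Longrightarrow> M ^\<^sub>m (ls ! d) *\<^sub>v u d = 0\<^sub>v n"
    and indep: "\<And>c. (\<And>x. x < n \<Longrightarrow> (\<Sum>d<length ls. c d * (M ^\<^sub>m (ls ! d - 1) *\<^sub>v u d) $ x) = 0)
        \<Longrightarrow> \<forall>d<length ls. c d = 0"
    and len: "sum_list ls = n"
  shows "\<exists>Q\<in>carrier_mat n n. det Q \<noteq> 0 \<and> K * Q = Q * diag_block_mat (map (\<lambda>l. jordan_block l 1) ls)"
proof -
  have M: "M \<in> carrier_mat n n" unfolding M_def by (rule minus_carrier_mat) simp
  define bs where "bs = map (\<lambda>d. (ls ! d, u d)) [0..<length ls]"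
  define xss where "xss = map (\<lambda>(l, u). jordan_string M l u) bs"
  define Q where "Q = mat_of_cols n (concat xss)"
  have fst: "map fst bs = ls" by (simp add: bs_def comp_def map_nth)
  have D: "map (\<lambda>(l, u). jordan_block l 1) bs = map (\<lambda>l. jordan_block l (1::'a)) ls"
    by (simp flip: fst) (auto simp: comp_def)
  have "u' \<in> carrier_vec n \<and> M ^\<^sub>m l *\<^sub>v u' = 0\<^sub>v n" if "(l, u') \<in> set bs" for l u'
    using that u nil by (auto simp: bs_def)
  note strings = jordan_strings_intertwine[OF K, of bs, folded M_def, OF this, folded xss_def, folded Q_def,
      unfolded D fst len]
  have lc: "length (concat xss) = n" and KQ: "K * Q = Q * diag_block_mat (map (\<lambda>l. jordan_block l 1) ls)"
    using strings by blast+
  have Q: "Q \<in> carrier_mat n n" by (auto simp: Q_def lc)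
  have xss: "length xss = length ls" "\<And>d. d < length ls \<Longrightarrow> xss ! d = jordan_string M (ls ! d) (u d)"
    by (auto simp: xss_def bs_def)
  have "w = 0\<^sub>v n" if w: "w \<in> carrier_vec n" "Q *\<^sub>v w = 0\<^sub>v n" for w
  proof (rule ccontr)
    assume "w \<noteq> 0\<^sub>v n"
    obtain \<phi> where \<phi>: "\<forall>F w. (\<Sum>c<n. F (concat xss ! c) * w c)
            = (\<Sum>d<length ls. \<Sum>i<length (xss ! d). F (xss ! d ! i) * w (\<phi> d i) :: 'a)"
     "\<forall>c<n. \<exists>d<length ls. \<exists>i<length (xss ! d). c = \<phi> d i"
      using sum_concat[of xss, where 'a='a] unfolding xss(1) lc by (elim exE conjE) (rule that)
    define f where "f d i = (if d < length ls \<and> i < ls ! d then w $ (\<phi> d i) else 0)" for d i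
    have rel: "(\<Sum>d<length ls. \<Sum>i<ls ! d. f d i * (M ^\<^sub>m (ls ! d - 1 - i) *\<^sub>v u d) $ x) = 0"
      if "x < n" for x
    proof -
      have "0 = (Q *\<^sub>v w) $ x" using w(2) that by simp
      also have "\<dots> = (\<Sum>c<n. (concat xss ! c) $ x * w $ c)"
        using w(1) that lc by (simp add: Q_def scalar_prod_def lessThan_atLeast0 mat_of_cols_index)
      also have "\<dots> = (\<Sum>d<length ls. \<Sum>i<length (xss ! d). (xss ! d ! i) $ x * w $ (\<phi> d i))"
        using \<phi>(1)[rule_format, of "\<lambda>v :: 'a vec. v $ x" "\<lambda>c. w $ c"] .
      also have "\<dots> = (\<Sum>d<length ls. \<Sum>i<ls ! d. f d i * (M ^\<^sub>m (ls ! d - 1 - i) *\<^sub>v u d) $ x)"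
        by (intro sum.cong) (auto simp: xss(2) length_jordan_string jordan_string_def f_def)
      finally show ?thesis by simp
    qed
    have ex: "\<exists>i d. f d i \<noteq> 0"
    proof -
      obtain c where c: "c < n" "w $ c \<noteq> 0" 
        using \<open>w \<noteq> 0\<^sub>v n\<close> w(1) by (metis carrier_vecD eq_vecI index_zero_vec)
      obtain d i where "d < length ls" "i < length (xss ! d)" "c = \<phi> d i" using \<phi>(2) c(1) by blast
      then have "f d i \<noteq> 0" using c(2) by (simp add: f_def xss(2) length_jordan_string)
      then show ?thesis by blast
    qed
    \<comment> \<open>Position i of a string of length l carries the power l - 1 - i, so M^I
      annihilates the positions below \<open>I\<close> and takes position \<open>I\<close> to the
      end of the string.\<close>
    define I where "I = Max {i. \<exists>d. f d i \<noteq> 0}"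
    have "i \<le> n" if "f d i \<noteq> 0" for d i
    proof -
      have "d < length ls" "i < ls ! d" using that by (auto simp: f_def split: if_splits)
      then show ?thesis using elem_le_sum_list[of d ls] len by simp
    qed
    then have "{i. \<exists>d. f d i \<noteq> 0} \<subseteq> {..n}" by blast
    then have fin: "finite {i. \<exists>d. f d i \<noteq> 0}" by (rule finite_subset) simp
    have I: "\<exists>d. f d I \<noteq> 0" using Max_in[OF fin] ex by (auto simp: I_def)
    have above: "f d i = 0" if "i > I" for d i
      using Max_ge[OF fin, of i] that by (auto simp: I_def)
    have "(\<Sum>d<length ls. f d I * (M ^\<^sub>m (ls ! d - 1) *\<^sub>v u d) $ x) = 0" if "x < n" for x
    proof -
      define A where "A = M ^\<^sub>m I"
      have A: "A \<in> carrier_mat n n" unfolding A_def by (rule pow_carrier_mat[OF M])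
      have b: "M ^\<^sub>m j *\<^sub>v u d \<in> carrier_vec n" if "d < length ls" for j d
        using M u[OF that] by (rule pow_mat_mult_vec_carrier)
      have "0 = (\<Sum>y<n. A $$ (x, y) *
          (\<Sum>d<length ls. \<Sum>i<ls ! d. f d i * (M ^\<^sub>m (ls ! d - 1 - i) *\<^sub>v u d) $ y))"
        by (rule sym, intro sum.neutral ballI) (simp only: rel lessThan_iff mult_zero_right)
      also have "\<dots> = (\<Sum>y<n. \<Sum>d<length ls. \<Sum>i<ls ! d. f d i *
          (A $$ (x, y) * (M ^\<^sub>m (ls ! d - 1 - i) *\<^sub>v u d) $ y))"
        by (simp only: sum_distrib_left mult.left_commute)
      also have "\<dots> = (\<Sum>d<length ls. \<Sum>y<n. \<Sum>i<ls ! d. f d i *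
          (A $$ (x, y) * (M ^\<^sub>m (ls ! d - 1 - i) *\<^sub>v u d) $ y))"
        by (rule sum.swap)
      also have "\<dots> = (\<Sum>d<length ls. \<Sum>i<ls ! d. \<Sum>y<n. f d i *
          (A $$ (x, y) * (M ^\<^sub>m (ls ! d - 1 - i) *\<^sub>v u d) $ y))"
        by (intro sum.cong refl sum.swap)
      also have "\<dots> = (\<Sum>d<length ls. \<Sum>i<ls ! d. f d i *
          (\<Sum>y<n. A $$ (x, y) * (M ^\<^sub>m (ls ! d - 1 - i) *\<^sub>v u d) $ y))"
        by (simp only: sum_distrib_left)
      also have "\<dots> = (\<Sum>d<length ls. \<Sum>i<ls ! d. if i = I then f d I * (M ^\<^sub>m (ls ! d - 1) *\<^sub>v u d) $ x else 0)"
      proof (intro sum.cong refl)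
        fix d i assume di: "d \<in> {..<length ls}" "i \<in> {..<ls ! d}"
        then have d: "d < length ls" and i: "i < ls ! d" by auto
        have "(\<Sum>y<n. A $$ (x, y) * (M ^\<^sub>m (ls ! d - 1 - i) *\<^sub>v u d) $ y)
           = (A *\<^sub>v (M ^\<^sub>m (ls ! d - 1 - i) *\<^sub>v u d)) $ x"
          by (rule mult_mat_vec_index_sum[OF A b[OF d] that, symmetric])
        also have "\<dots> = (M ^\<^sub>m (I + (ls ! d - 1 - i)) *\<^sub>v u d) $ x"
          by (simp only: A_def pow_mat_mult_vec_add[OF M u[OF d]])
        finally have eq: "(\<Sum>y<n. A $$ (x, y) * (M ^\<^sub>m (ls ! d - 1 - i) *\<^sub>v u d) $ y)
           = (M ^\<^sub>m (I + (ls ! d - 1 - i)) *\<^sub>v u d) $ x" .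
        consider "i < I" | "i = I" | "i > I" by linarith
        then show "f d i * (\<Sum>y<n. A $$ (x, y) * (M ^\<^sub>m (ls ! d - 1 - i) *\<^sub>v u d) $ y)
          = (if i = I then f d I * (M ^\<^sub>m (ls ! d - 1) *\<^sub>v u d) $ x else 0)"
        proof cases
          case 1
          then have "ls ! d \<le> I + (ls ! d - 1 - i)" using i by simp
          from pow_mat_mult_vec_zero[OF M u[OF d] nil[OF d] this]
          show ?thesis unfolding eq using 1 that by simp
        next
          case 2
          then have "I + (ls ! d - 1 - i) = ls ! d - 1" using i by simp
          then show ?thesis unfolding eq by (simp only: 2 if_True refl)
        next
          case 3
          then show ?thesis using above by simp
        qed
      qed
      also have "\<dots> = (\<Sum>d<length ls. f d I * (M ^\<^sub>m (ls ! d - 1) *\<^sub>v u d) $ x)"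
        by (intro sum.cong refl) (auto simp: f_def)
      finally show ?thesis by simp
    qed
    then have "\<forall>d<length ls. f d I = 0" by (rule indep)
    then show False using I by (auto simp: f_def split: if_splits)
  qed
  then have "det Q \<noteq> 0" using det_0_iff_vec_prod_zero_field[OF Q] by blast
  then show ?thesis using Q KQ by blast
qed

section \<open>The tensor product as a graded module\<close>

locale cyclic_char_group =
  fixes G :: "('g, 'b) monoid_scheme" and g :: 'g and a :: nat and field_type :: "'a::field itself"
  assumes G: "group G" "g \<in> carrier G" "generate G {g} = carrier G"
    and char: "prime CHAR('a)" "order G = CHAR('a) ^ a" and a: "a \<ge> 1"
begin

abbreviation J :: "nat \<Rightarrow> 'a mat" where "J s \<equiv> jordan_block s 1"

abbreviation K :: "nat \<Rightarrow> nat \<Rightarrow> 'a mat" where "K r s \<equiv> kron_mat (J r) (J s)"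

lemma V_rep_generator: "V_rep G g s g = J s"
proof -
  interpret group G by (rule G(1))
  \<comment> \<open>Since a \<ge> 1, the group is nontrivial; otherwise the least exponent of
    \<open>g\<close> would be 0 instead of 1.\<close>
  have "g \<noteq> \<one>\<^bsub>G\<^esub>"
  proof
    assume "g = \<one>\<^bsub>G\<^esub>"
    then have "carrier G = {\<one>\<^bsub>G\<^esub>}" using G(3) generate_one by simp
    then have "CHAR('a) ^ a = 1" using char(2) by (simp add: order_def)
    then show False using char(1) a by (simp add: prime_nat_iff)
  qed
  then have "(LEAST k::nat. g [^]\<^bsub>G\<^esub> k = g) = 1"
    using G(2) by (intro Least_equality) (auto intro!: Suc_leI gr0I)
  then show ?thesis by (simp add: V_rep_def)
qed

lemma V_tensor_generator: "V_tensor G g r s g = K r s"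
  by (simp add: rep_tensor_def V_rep_generator)

lemma K_carrier: "K r s \<in> carrier_mat (r * s) (r * s)"
  by (intro kron_mat_carrier) auto

lemma K_minus_carrier: "K r s - 1\<^sub>m (r * s) \<in> carrier_mat (r * s) (r * s)"
  by (rule minus_carrier_mat) simp

definition W :: "int \<Rightarrow> nat \<Rightarrow> nat \<Rightarrow> 'a mat" where
  "W N s i = V_rep G g s (g [^]\<^bsub>G\<^esub> (N - int i))"

lemma W_props:
  assumes "s \<le> order G"
  shows "W N s i \<in> carrier_mat s s" "J s * W N s (Suc i) = W N s i" "J s * W N s i = W N s i * J s"
    and "\<exists>B. B \<in> carrier_mat s s \<and> B * W N s i = 1\<^sub>m s"
proof -
  interpret group G by (rule G(1))
  have rep: "is_rep G s (V_rep G g s :: 'g \<Rightarrow> 'a mat)"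
    by (rule is_rep_V_rep[OF G char assms])
  have carr: "(V_rep G g s x :: 'a mat) \<in> carrier_mat s s" if "x \<in> carrier G" for x
    using rep that unfolding is_rep_def by blast
  have mult: "V_rep G g s (x \<otimes>\<^bsub>G\<^esub> y) = V_rep G g s x * (V_rep G g s y :: 'a mat)"
    if "x \<in> carrier G" "y \<in> carrier G" for x y
    using rep that unfolding is_rep_def by blast
  have one: "V_rep G g s \<one>\<^bsub>G\<^esub> = (1\<^sub>m s :: 'a mat)"
    using rep unfolding is_rep_def by blast
  have pow: "g [^]\<^bsub>G\<^esub> (k::int) \<in> carrier G" for k using G(2) by simp
  show "W N s i \<in> carrier_mat s s" unfolding W_def by (rule carr[OF pow])
  have g1: "g [^]\<^bsub>G\<^esub> (1::int) = g" using G(2) by simp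
  have "g \<otimes>\<^bsub>G\<^esub> g [^]\<^bsub>G\<^esub> (k::int) = g [^]\<^bsub>G\<^esub> (1 + k)" for k
    using int_pow_mult[OF G(2), of 1 k] g1 by simp
  moreover have "g [^]\<^bsub>G\<^esub> (k::int) \<otimes>\<^bsub>G\<^esub> g = g [^]\<^bsub>G\<^esub> (1 + k)" for k
    using int_pow_mult[OF G(2), of k 1] g1 by (simp add: add.commute)
  ultimately have left: "J s * V_rep G g s (g [^]\<^bsub>G\<^esub> k) = V_rep G g s (g [^]\<^bsub>G\<^esub> (1 + k))"
    and right: "V_rep G g s (g [^]\<^bsub>G\<^esub> k) * J s = V_rep G g s (g [^]\<^bsub>G\<^esub> (1 + k))" for k :: int
    using mult[OF G(2) pow[of k]] mult[OF pow[of k] G(2)] by (simp_all add: V_rep_generator)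
  show "J s * W N s (Suc i) = W N s i" unfolding W_def left by simp
  show "J s * W N s i = W N s i * J s" unfolding W_def left right ..
  have "V_rep G g s (g [^]\<^bsub>G\<^esub> (int i - N)) * W N s i = V_rep G g s (g [^]\<^bsub>G\<^esub> (int i - N + (N - int i)))"
    unfolding W_def by (simp only: mult[OF pow pow, symmetric] int_pow_mult[OF G(2)])
  also have "\<dots> = 1\<^sub>m s" using one by simp
  finally show "\<exists>B. B \<in> carrier_mat s s \<and> B * W N s i = 1\<^sub>m s" using carr[OF pow] by blast
qed

lemma v_basis_eq:
  assumes s: "s \<le> order G" and ij: "i \<in> {1..r}" "j \<in> {1..s}"
  shows "v_basis G g N r s i j = twisted_vec (W N s) r s (\<lambda>i' j'. if i' = i \<and> j' = j then 1 else 0)"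
proof (rule eq_vec_prodI)
  have W: "W N s i \<in> carrier_mat s s" for i by (rule W_props(1)[OF s])
  have v: "(v_basis G g N r s i j :: 'a vec) = kron_vec (unit_vec r (i - 1)) (W N s i *\<^sub>v unit_vec s (j - 1))"
    using ij by (simp add: v_basis_def W_def)
  have dim: "dim_vec (W N s i *\<^sub>v unit_vec s (j - 1)) = s" using W[of i] by simp
  show "(v_basis G g N r s i j :: 'a vec) \<in> carrier_vec (r * s)"
    unfolding v kron_vec_def dim by simp
  show "twisted_vec (W N s) r s (\<lambda>i' j'. if i' = i \<and> j' = j then 1 else 0) \<in> carrier_vec (r * s)"
    by (rule twisted_vec_carrier)
  fix i' j' assume ij': "i' < r" "j' < s"
  have "v_basis G g N r s i j $ (i' * s + j') = unit_vec r (i - 1) $ i' * (W N s i *\<^sub>v unit_vec s (j - 1)) $ j'"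
    unfolding v kron_vec_def dim using ij' pair_index[OF ij'] by (simp add: pair_index_div)
  also have "\<dots> = (W N s (i' + 1) *\<^sub>v vec s (\<lambda>j'. if i' + 1 = i \<and> j' + 1 = j then 1 else 0)) $ j'"
  proof (cases "i' + 1 = i")
    case True
    have "unit_vec s (j - 1) = vec s (\<lambda>j'. if i' + 1 = i \<and> j' + 1 = j then 1 else (0 :: 'a))"
      using ij True by (intro eq_vecI) (auto simp: unit_vec_def)
    then show ?thesis using True ij' by (auto simp: unit_vec_def)
  next
    case False
    then have "unit_vec r (i - 1) $ i' = (0 :: 'a)" using ij ij' by (auto simp: unit_vec_def)
    then show ?thesis using False W[of "i' + 1"] ij' by (simp add: scalar_prod_def)
  qed
  finally show "v_basis G g N r s i j $ (i' * s + j')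
    = twisted_vec (W N s) r s (\<lambda>i' j'. if i' = i \<and> j' = j then 1 else 0) $ (i' * s + j')"
    using ij' by (simp add: twisted_vec_index)
qed

lemma v_basis_sum:
  assumes s: "s \<le> order G" and I: "finite I" "\<And>k. k \<in> I \<Longrightarrow> \<alpha> k \<in> {1..r} \<and> \<beta> k \<in> {1..s}"
  shows "finsum_vec TYPE('a) (r * s) (\<lambda>k. c k \<cdot>\<^sub>v v_basis G g N r s (\<alpha> k) (\<beta> k)) I
    = twisted_vec (W N s) r s (\<lambda>i j. \<Sum>k\<in>I. c k * (if i = \<alpha> k \<and> j = \<beta> k then 1 else 0))"
proof (rule eq_vecI)
  have v: "(v_basis G g N r s (\<alpha> k) (\<beta> k) :: 'a vec)
      = twisted_vec (W N s) r s (\<lambda>i j. if i = \<alpha> k \<and> j = \<beta> k then 1 else 0)" if "k \<in> I" for k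
    using I(2)[OF that] by (intro v_basis_eq[OF s]) auto
  then have carr: "(\<lambda>k. c k \<cdot>\<^sub>v (v_basis G g N r s (\<alpha> k) (\<beta> k) :: 'a vec)) \<in> I \<rightarrow> carrier_vec (r * s)"
    using twisted_vec_carrier by (intro Pi_I smult_carrier_vec[THEN iffD2]) simp
  show "dim_vec (finsum_vec TYPE('a) (r * s) (\<lambda>k. c k \<cdot>\<^sub>v v_basis G g N r s (\<alpha> k) (\<beta> k)) I)
    = dim_vec (twisted_vec (W N s) r s (\<lambda>i j. \<Sum>k\<in>I. c k * (if i = \<alpha> k \<and> j = \<beta> k then 1 else 0)))"
    using carrier_vecD[OF finsum_vec_closed[OF carr]] by (simp add: twisted_vec_def)
  fix x assume "x < dim_vec (twisted_vec (W N s) r s (\<lambda>i j. \<Sum>k\<in>I. c k * (if i = \<alpha> k \<and> j = \<beta> k then 1 else 0)))"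
  then have x: "x < r * s" by (simp add: twisted_vec_def)
  have dim: "dim_vec (twisted_vec (W N s) r s c) = r * s" for c by (simp add: twisted_vec_def)
  show "finsum_vec TYPE('a) (r * s) (\<lambda>k. c k \<cdot>\<^sub>v v_basis G g N r s (\<alpha> k) (\<beta> k)) I $ x
    = twisted_vec (W N s) r s (\<lambda>i j. \<Sum>k\<in>I. c k * (if i = \<alpha> k \<and> j = \<beta> k then 1 else 0)) $ x"
    unfolding index_finsum_vec[OF I(1) x carr]
    by (subst twisted_vec_sum_index[OF W_props(1)[OF s] I(1) x], rule sum.cong[OF refl])
      (simp add: v dim x)
qed

text \<open>Here v_{i,j} stands for X^(r-i) Y^(s-j), and \<open>p\<close> lists the coefficients of
  a homogeneous element of degree \<delta> by the power of X. Coefficients of monomials that vanish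
  modulo X^r and Y^s are ignored.\<close>

definition graded_vec :: "int \<Rightarrow> nat \<Rightarrow> nat \<Rightarrow> nat \<Rightarrow> 'a poly \<Rightarrow> 'a vec" where
  "graded_vec N r s \<delta> p = twisted_vec (W N s) r s (\<lambda>i j. if (r - i) + (s - j) = \<delta> then coeff p (r - i) else 0)"

lemma graded_vec_carrier: "graded_vec N r s \<delta> p \<in> carrier_vec (r * s)"
  unfolding graded_vec_def by (rule twisted_vec_carrier)

lemma graded_vec_eq_iff:
  assumes "s \<le> order G" "0 < s"
  shows "graded_vec N r s \<delta> p = graded_vec N r s \<delta> p' \<longleftrightarrow>
    (\<forall>i<r. i \<le> \<delta> \<and> \<delta> < i + s \<longrightarrow> coeff p i = coeff p' i)"
proof
  assume eq: "graded_vec N r s \<delta> p = graded_vec N r s \<delta> p'"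
  obtain W' where W': "\<And>i. W' i \<in> carrier_mat s s \<and> W' i * W N s i = 1\<^sub>m s"
    using W_props(4)[OF assms(1)] by metis
  note inj = twisted_vec_inject[OF W_props(1)[OF assms(1)] W' eq[unfolded graded_vec_def]]
  show "\<forall>i<r. i \<le> \<delta> \<and> \<delta> < i + s \<longrightarrow> coeff p i = coeff p' i"
  proof (intro allI impI)
    fix i assume i: "i < r" "i \<le> \<delta> \<and> \<delta> < i + s"
    have "r - i \<in> {1..r}" "s - (\<delta> - i) \<in> {1..s}" "(r - (r - i)) + (s - (s - (\<delta> - i))) = \<delta>" "r - (r - i) = i"
      using i assms(2) by auto
    then show "coeff p i = coeff p' i" using inj[of "r - i" "s - (\<delta> - i)"] by simp
  qed
next
  assume coeff: "\<forall>i<r. i \<le> \<delta> \<and> \<delta> < i + s \<longrightarrow> coeff p i = coeff p' i"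
  show "graded_vec N r s \<delta> p = graded_vec N r s \<delta> p'"
    unfolding graded_vec_def
  proof (rule twisted_vec_cong)
    fix i j assume "i \<in> {1..r}" "j \<in> {1..s}"
    then have ij: "r - i < r" "s - j < s" by auto
    then show "(if (r - i) + (s - j) = \<delta> then coeff p (r - i) else 0)
      = (if (r - i) + (s - j) = \<delta> then coeff p' (r - i) else 0)"
      using coeff[rule_format, OF ij(1)] by (cases "(r - i) + (s - j) = \<delta>") auto
  qed
qed

lemma graded_vec_step:
  assumes s: "s \<le> order G" and p: "degree p \<le> \<delta>"
  shows "(K r s - 1\<^sub>m (r * s)) *\<^sub>v graded_vec N r s \<delta> p = graded_vec N r s (Suc \<delta>) ([:1, 1:] * p)"
  unfolding graded_vec_def kron_jordan_twisted_vec[where W = "W N s", OF W_props(1-3)[OF s]]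
proof (rule twisted_vec_cong)
  fix i j assume "i \<in> {1..r}" "j \<in> {1..s}"
  then have ij: "1 \<le> i" "i \<le> r" "1 \<le> j" "j \<le> s" by auto
  let ?c = "\<lambda>i j. if (r - i) + (s - j) = \<delta> then coeff p (r - i) else 0"
  have a: "(if i < r then ?c (i + 1) j else 0)
      = (if (r - i) + (s - j) = Suc \<delta> then (if r - i = 0 then 0 else coeff p (r - i - 1)) else 0)"
  proof (cases "i < r")
    case True
    then have "r - i = Suc (r - (i + 1))" by simp
    then show ?thesis using True by simp
  qed simp
  have b: "(if j < s then ?c i (j + 1) else 0)
      = (if (r - i) + (s - j) = Suc \<delta> then coeff p (r - i) else 0)"
  proof (cases "j < s")
    case True
    then have "s - j = Suc (s - (j + 1))" by simp
    then show ?thesis using True by simp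
  next
    case False
    then have "s - j = 0" using ij by simp
    \<comment> \<open>At j = s the exponent of Y is 0, and the degree bound makes the coefficient of
      X^(\<delta>+1) in \<open>p\<close> vanish.\<close>
    then show ?thesis using False p by (auto intro!: coeff_eq_0)
  qed
  show "(if i < r then ?c (i + 1) j else 0) + (if j < s then ?c i (j + 1) else 0)
     = (if (r - i) + (s - j) = Suc \<delta> then coeff ([:1, 1:] * p) (r - i) else 0)"
    unfolding a b coeff_linear_mult by (simp add: add.commute)
qed

lemma degree_linear_power_mult: "degree ([:1, 1:] ^ k * p) \<le> degree p + k" for p :: "'a poly"
  using degree_mult_le[of "[:1, 1:] ^ k" p] degree_linear_power[of k, where 'a='a] by linarith

lemma graded_vec_pow:
  assumes s: "s \<le> order G" and p: "degree p \<le> \<delta>"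
  shows "(K r s - 1\<^sub>m (r * s)) ^\<^sub>m k *\<^sub>v graded_vec N r s \<delta> p = graded_vec N r s (\<delta> + k) ([:1, 1:] ^ k * p)"
proof (induction k)
  case 0
  then show ?case using K_minus_carrier[of r s] graded_vec_carrier[of N r s \<delta> p] by (simp add: carrier_matD)
next
  case (Suc k)
  have deg: "degree ([:1, 1:] ^ k * p) \<le> \<delta> + k"
    using degree_linear_power_mult[of k p] p by linarith
  show ?case
    unfolding pow_mat_mult_vec_Suc[OF K_minus_carrier graded_vec_carrier] Suc graded_vec_step[OF s deg]
    by (simp only: power_Suc mult.assoc add_Suc_right)
qed

text \<open>The vector v_{r-l+j,s+1-j} is X^(l-j) Y^(j-1), of degree l - 1.\<close>

lemma v_basis_sum_graded:
  assumes s: "s \<le> order G" and l: "1 \<le> l" "l \<le> min r s"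
  shows "finsum_vec TYPE('a) (r * s) (\<lambda>j. c j \<cdot>\<^sub>v v_basis G g N r s (r - l + j) (s + 1 - j)) {1..l}
    = graded_vec N r s (l - 1) (\<Sum>j\<in>{1..l}. monom (c j) (l - j))"
proof -
  have mem: "r - l + k \<in> {1..r} \<and> s + 1 - k \<in> {1..s}" if "k \<in> {1..l}" for k
  proof -
    have "1 \<le> k" "k \<le> l" using that by auto
    then show ?thesis using l by auto
  qed
  have coeffs: "(\<Sum>k\<in>{1..l}. c k * (if i = r - l + k \<and> j = s + 1 - k then 1 else 0))
      = (if (r - i) + (s - j) = l - 1 then coeff (\<Sum>k\<in>{1..l}. monom (c k) (l - k)) (r - i) else 0)"
    if "i \<in> {1..r}" "j \<in> {1..s}" for i j
  proof -
    have ij: "1 \<le> i" "i \<le> r" "1 \<le> j" "j \<le> s" using that by auto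
    have "(\<Sum>k\<in>{1..l}. c k * (if i = r - l + k \<and> j = s + 1 - k then 1 else 0))
        = (\<Sum>k\<in>{1..l}. if (r - i) + (s - j) = l - 1 then coeff (monom (c k) (l - k)) (r - i) else 0)"
    proof (intro sum.cong refl)
      fix k assume "k \<in> {1..l}"
      then have k: "1 \<le> k" "k \<le> l" by auto
      have "(i = r - l + k \<and> j = s + 1 - k) \<longleftrightarrow> (r - i) + (s - j) = l - 1 \<and> l - k = r - i"
        using ij k l by auto
      then show "c k * (if i = r - l + k \<and> j = s + 1 - k then 1 else 0)
        = (if (r - i) + (s - j) = l - 1 then coeff (monom (c k) (l - k)) (r - i) else 0)" by simp
    qed
    also have "\<dots> = (if (r - i) + (s - j) = l - 1 then coeff (\<Sum>k\<in>{1..l}. monom (c k) (l - k)) (r - i) else 0)"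
      by (simp add: coeff_sum)
    finally show ?thesis .
  qed
  show ?thesis
    unfolding graded_vec_def
    using v_basis_sum[OF s finite_atLeastAtMost mem, where c = c and N = N] twisted_vec_cong[OF coeffs]
    by simp
qed

lemma x_vec_eq_graded:
  assumes s: "s \<le> order G" and d: "1 \<le> d" "d \<le> min r s"
  shows "x_vec G g N r s d = graded_vec N r s (r + s - 1 - d) (alt_poly r d)"
proof -
  have mem: "k \<in> {1..r} \<and> d + 1 - k \<in> {1..s}" if "k \<in> {1..d}" for k
  proof -
    have "1 \<le> k" "k \<le> d" using that by auto
    then show ?thesis using d by auto
  qed
  have coeffs: "(\<Sum>k\<in>{1..d}. (-1) ^ (k - 1) * (if i = k \<and> j = d + 1 - k then 1 else 0 :: 'a))
      = (if (r - i) + (s - j) = r + s - 1 - d then coeff (alt_poly r d) (r - i) else 0)"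
    if "i \<in> {1..r}" "j \<in> {1..s}" for i j
  proof -
    have ij: "1 \<le> i" "i \<le> r" "1 \<le> j" "j \<le> s" using that by auto
    have "(\<Sum>k\<in>{1..d}. (-1) ^ (k - 1) * (if i = k \<and> j = d + 1 - k then 1 else 0 :: 'a))
        = (\<Sum>k\<in>{1..d}. if i = k then (if j = d + 1 - i then (-1) ^ (i - 1) else 0) else 0)"
      by (intro sum.cong) auto
    also have "\<dots> = (if i \<le> d \<and> j = d + 1 - i then (-1) ^ (i - 1) else 0)"
      using ij by simp
    also have "\<dots> = (if (r - i) + (s - j) = r + s - 1 - d then coeff (alt_poly r d) (r - i) else 0)"
    proof -
      have "i \<le> d \<and> j = d + 1 - i \<longleftrightarrow> (r - i) + (s - j) = r + s - 1 - d" using ij d by auto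
      moreover have "r - 1 - (r - i) = i - 1" using ij by simp
      moreover have "r - i \<in> {r - d..<r}" if "i \<le> d" using that ij d by auto
      ultimately show ?thesis by (auto simp: coeff_alt_poly)
    qed
    finally show ?thesis .
  qed
  show ?thesis
    unfolding x_vec_def graded_vec_def
    using v_basis_sum[OF s finite_atLeastAtMost mem, where c = "\<lambda>i. (-1) ^ (i - 1)" and N = N]
      twisted_vec_cong[OF coeffs]
    by simp
qed

lemma graded_vec_alt_iff:
  assumes "s \<le> order G" "0 < s" "1 \<le> d" "d \<le> min r s"
  shows "graded_vec N r s (r + s - 1 - d) ([:1, 1:] ^ (h - 1) * y) = graded_vec N r s (r + s - 1 - d) (alt_poly r d)
    \<longleftrightarrow> hits_top r d h y"
proof -
  have "i \<le> r + s - 1 - d \<and> r + s - 1 - d < i + s \<longleftrightarrow> i \<in> {r - d..<r}" if "i < r" for i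
    using that assms by auto
  then show ?thesis
    unfolding graded_vec_eq_iff[OF assms(1,2)] hits_top_def by (auto simp: coeff_alt_poly)
qed

end

section \<open>The decomposition and the matrix \<open>J(r,s)\<close>\<close>

context cyclic_char_group
begin

lemma rep_dsum_V_rep:
  "rep_dsum (map (V_rep G g) ls) x
     = diag_block_mat (map J ls) ^\<^sub>m (LEAST k::nat. g [^]\<^bsub>G\<^esub> k = x)"
proof -
  have "Ball (set (map J ls)) square_mat" by auto
  then show ?thesis
    by (simp add: rep_dsum_def V_rep_def diag_block_pow_mat comp_def)
qed

lemma diag_J_eq_jordan_matrix: "diag_block_mat (map J ls) = jordan_matrix (map (\<lambda>l. (l, 1)) ls)"
  by (simp add: jordan_matrix_def comp_def)

lemma diag_J_carrier: "diag_block_mat (map J ls) \<in> carrier_mat (sum_list ls) (sum_list ls)"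
  using jordan_matrix_carrier[of "map (\<lambda>l. (l, 1::'a)) ls"]
  unfolding diag_J_eq_jordan_matrix by (simp add: comp_def)

lemma decomposes_into_jordan_nf:
  assumes "decomposes_into G g (\<rho> :: 'g \<Rightarrow> 'a mat) m ls"
  shows "jordan_nf (\<rho> g) (map (\<lambda>l. (l, 1)) ls)"
proof -
  let ?D = "diag_block_mat (map J ls)"
  have D: "rep_dsum (map (V_rep G g) ls) g = ?D"
    by (simp add: rep_dsum_def V_rep_generator comp_def)
  obtain d P where P: "P \<in> carrier_mat d d" "invertible_mat P"
    "\<rho> g \<in> carrier_mat d d" "?D \<in> carrier_mat d d" "P * \<rho> g = ?D * P"
    using assms G(2) D unfolding decomposes_into_def rep_iso_def by metis
  obtain B where B: "inverts_mat P B" "inverts_mat B P"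
    using P(2) by (auto simp: invertible_mat_def)
  have PB: "P * B = 1\<^sub>m d" using B(1) P(1) by (auto simp: inverts_mat_def)
  then have "dim_col B = d" by (metis index_mult_mat(3) index_one_mat(3))
  moreover have BP: "B * P = 1\<^sub>m (dim_row B)" using B(2) by (auto simp: inverts_mat_def)
  then have "dim_row B = d" using P(1) by (metis carrier_matD(2) index_mult_mat(3) index_one_mat(3))
  ultimately have Bc: "B \<in> carrier_mat d d" and BP: "B * P = 1\<^sub>m d"
    using BP by auto
  have "\<rho> g = B * (P * \<rho> g)"
    using assoc_mult_mat[OF Bc P(1) P(3)] BP P(3) by simp
  also have "\<dots> = B * ?D * P" unfolding P(5) using assoc_mult_mat[OF Bc P(4) P(1)] by simp
  finally have "similar_mat (\<rho> g) ?D"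
    using P Bc PB BP by (intro similar_matI[of _ _ B P d]) auto
  moreover have "\<forall>l\<in>set ls. 0 < l" using assms by (simp add: decomposes_into_def)
  ultimately show ?thesis
    unfolding jordan_nf_def diag_J_eq_jordan_matrix by auto
qed

text \<open>Evaluation at \<open>g\<close> makes both lists Jordan normal forms of one matrix, which
  determines the number of blocks of each size.\<close>

lemma decomposes_into_unique:
  assumes "decomposes_into G g (\<rho> :: 'g \<Rightarrow> 'a mat) m ls" "decomposes_into G g \<rho> m' ls'"
  shows "ls = ls'"
proof -
  have pos: "0 \<notin> set ls" "0 \<notin> set ls'"
    and sorted: "sorted (rev ls)" "sorted (rev ls')"
    using assms by (auto simp: decomposes_into_def sorted_wrt_rev)
  have len: "length (filter ((=) (k, 1)) (map (\<lambda>l. (l, 1::'a)) ns)) = count (mset ns) k" for k ns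
    by (induction ns) auto
  have "mset ls = mset ls'"
  proof (rule multiset_eqI)
    fix k show "count (mset ls) k = count (mset ls') k"
    proof (cases "k = 0")
      case True
      then show ?thesis using pos by (metis not_in_iff set_mset_mset)
    next
      case False
      show ?thesis
        using compute_nr_of_jordan_blocks[OF decomposes_into_jordan_nf[OF assms(1)] False, of 1]
          compute_nr_of_jordan_blocks[OF decomposes_into_jordan_nf[OF assms(2)] False, of 1]
        unfolding len by (rule trans[OF sym])
    qed
  qed
  then have "sort (rev ls) = rev ls'"
    using sorted(2) by (intro properties_for_sort) simp_all
  then show ?thesis
    using sorted(1) by (simp add: sorted_sort_id)
qed

lemma ex_block_gen_graded:
  assumes s: "s \<le> order G" and d: "d \<in> {1..min r s}"
  defines "h \<equiv> height TYPE('a) r s d"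
  shows "\<exists>u\<in>carrier_vec (r * s).
      (K r s - 1\<^sub>m (r * s)) ^\<^sub>m (h - 1) *\<^sub>v u = graded_vec 0 r s (r + s - 1 - d) (alt_poly r d) \<and>
      (K r s - 1\<^sub>m (r * s)) ^\<^sub>m h *\<^sub>v u = 0\<^sub>v (r * s)"
proof -
  have d': "1 \<le> d" "d \<le> min r s" and s0: "0 < s" using d by auto
  have h: "1 \<le> h" using height_pos[OF d] by (simp add: h_def)
  obtain y :: "'a poly" where y: "hits_top r d h y" "degree y + d + h \<le> r + s"
    using ex_hits_top[OF d, where 'a='a] by (auto simp: h_def)
  obtain U V where UV: "pade r s d h U V" "[:1, 1:] ^ h * y = monom 1 r * U + V"
    using hits_top_imp_pade[OF y h d'] by blast
  define \<delta> where "\<delta> = r + s - d - h"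
  have deg: "degree y \<le> \<delta>" using y(2) by (simp add: \<delta>_def)
  have \<delta>: "\<delta> + (h - 1) = r + s - 1 - d" "\<delta> + h = r + s - d"
    using y(2) h by (simp_all add: \<delta>_def)
  have "graded_vec 0 r s (r + s - d) ([:1, 1:] ^ h * y) = graded_vec 0 r s (r + s - d) 0"
    unfolding graded_vec_eq_iff[OF s s0]
  proof (intro allI impI)
    \<comment> \<open>A surviving monomial has X-exponent i with r - d < i < r: above deg V and
      below every term of X^r U.\<close>
    fix i assume i: "i < r" "i \<le> r + s - d \<and> r + s - d < i + s"
    then have "degree V < i" using UV(1) d' by (auto simp: pade_def)
    then show "coeff ([:1, 1:] ^ h * y) i = coeff 0 i"
      using i(1) by (simp add: UV(2) coeff_monom_mult coeff_eq_0)
  qed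
  also have "\<dots> = 0\<^sub>v (r * s)"
  proof (rule eq_vecI)
    fix x assume "x < dim_vec (0\<^sub>v (r * s) :: 'a vec)"
    then have x: "x < r * s" by simp
    show "graded_vec 0 r s (r + s - d) 0 $ x = 0\<^sub>v (r * s) $ x"
      using twisted_vec_sum_index[OF W_props(1)[OF s] finite.emptyI x] x
      by (simp add: graded_vec_def cong: if_cong)
  qed (simp add: graded_vec_def twisted_vec_def)
  finally have zero: "graded_vec 0 r s (r + s - d) ([:1, 1:] ^ h * y) = 0\<^sub>v (r * s)" .
  show ?thesis
  proof (rule bexI[OF _ graded_vec_carrier[of 0 r s \<delta> y]], intro conjI)
    show "(K r s - 1\<^sub>m (r * s)) ^\<^sub>m (h - 1) *\<^sub>v graded_vec 0 r s \<delta> y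
        = graded_vec 0 r s (r + s - 1 - d) (alt_poly r d)"
      unfolding graded_vec_pow[OF s deg] \<delta> using graded_vec_alt_iff[OF s s0 d'] y(1) by blast
    show "(K r s - 1\<^sub>m (r * s)) ^\<^sub>m h *\<^sub>v graded_vec 0 r s \<delta> y = 0\<^sub>v (r * s)"
      unfolding graded_vec_pow[OF s deg] \<delta> by (rule zero)
  qed
qed

lemma alt_graded_independent:
  assumes s: "s \<le> order G" and zero: "\<And>x. x < r * s \<Longrightarrow>
      (\<Sum>d<min r s. c d * graded_vec N r s (r + s - 1 - Suc d) (alt_poly r (Suc d)) $ x) = 0"
    and d: "d < min r s"
  shows "c d = 0"
proof -
  obtain W' where W': "\<And>i. W' i \<in> carrier_mat s s \<and> W' i * W N s i = 1\<^sub>m s"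
    using W_props(4)[OF s] by metis
  define C where "C d i j = (if (r - i) + (s - j) = r + s - 1 - Suc d then coeff (alt_poly r (Suc d)) (r - i) else 0 :: 'a)"
    for d i j
  have "twisted_vec (W N s) r s (\<lambda>i j. \<Sum>d<min r s. c d * C d i j) = twisted_vec (W N s) r s (\<lambda>i j. 0)"
  proof (rule eq_vecI)
    fix x assume "x < dim_vec (twisted_vec (W N s) r s (\<lambda>i j. 0 :: 'a))"
    then have x: "x < r * s" by (simp add: twisted_vec_def)
    have "twisted_vec (W N s) r s (\<lambda>i j. \<Sum>d<min r s. c d * C d i j) $ x = 0"
      unfolding twisted_vec_sum_index[OF W_props(1)[OF s] finite_lessThan x]
      using zero[OF x] by (simp only: graded_vec_def C_def)
    moreover have "twisted_vec (W N s) r s (\<lambda>i j. 0 :: 'a) $ x = 0"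
      using twisted_vec_sum_index[OF W_props(1)[OF s] finite.emptyI x] by simp
    ultimately show "twisted_vec (W N s) r s (\<lambda>i j. \<Sum>d<min r s. c d * C d i j) $ x
      = twisted_vec (W N s) r s (\<lambda>i j. 0) $ x" by simp
  qed (simp add: twisted_vec_def)
  note inj = twisted_vec_inject[OF W_props(1)[OF s] W' this]
  \<comment> \<open>The basis vector v_{1,d+1} occurs in x_{d+1} alone, with coefficient 1, so its
    coordinate isolates \<open>c d\<close>.\<close>
  have "(\<Sum>d'<min r s. c d' * C d' 1 (Suc d)) = 0"
    using d by (intro inj) auto
  moreover have "C d' 1 (Suc d) = (if d' = d then 1 else 0)" if "d' < min r s" for d'
  proof -
    have "(r - 1) + (s - Suc d) = r + s - 1 - Suc d' \<longleftrightarrow> d' = d" using that d by auto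
    moreover have "r - 1 \<in> {r - Suc d..<r}" using d by auto
    ultimately show ?thesis by (auto simp: C_def coeff_alt_poly)
  qed
  then have "(\<Sum>d'<min r s. c d' * C d' 1 (Suc d)) = (\<Sum>d'<min r s. if d' = d then c d' else 0)"
    by (intro sum.cong) auto
  ultimately show ?thesis using d by simp
qed

lemma nth_heights: "d < min r s \<Longrightarrow> heights TYPE('a) r s ! d = height TYPE('a) r s (Suc d)"
  using part_heights[of "Suc d" r s "TYPE('a)"] by simp

lemma sum_list_heights: "sum_list (heights TYPE('a) r s) = r * s"
  unfolding sum_height[where 'a='a, symmetric] heights_def
  by (simp add: sum_list_distinct_conv_sum_set atLeastLessThanSuc_atLeastAtMost del: upt_Suc)

text \<open>The strings end in the independent vectors x_d and their lengths add up to r * s, so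
  they form a Jordan basis for \<open>g\<close>.\<close>

lemma decomposes_into_heights:
  assumes s: "s \<le> order G"
  shows "decomposes_into G g (V_tensor G g r s :: 'g \<Rightarrow> 'a mat) (min r s) (heights TYPE('a) r s)"
proof -
  let ?ls = "heights TYPE('a) r s" and ?n = "r * s" and ?K = "K r s"
  let ?M = "?K - 1\<^sub>m ?n" and ?D = "diag_block_mat (map J ?ls)"
  have ls: "length ?ls = min r s" by (rule length_heights)
  have "\<forall>d\<in>{..<min r s}. \<exists>u. u \<in> carrier_vec ?n \<and>
      ?M ^\<^sub>m (?ls ! d - 1) *\<^sub>v u = graded_vec 0 r s (r + s - 1 - Suc d) (alt_poly r (Suc d)) \<and>
      ?M ^\<^sub>m (?ls ! d) *\<^sub>v u = 0\<^sub>v ?n"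
  proof
    fix d assume "d \<in> {..<min r s}"
    then have d: "d < min r s" "Suc d \<in> {1..min r s}" by auto
    show "\<exists>u. u \<in> carrier_vec ?n \<and>
      ?M ^\<^sub>m (?ls ! d - 1) *\<^sub>v u = graded_vec 0 r s (r + s - 1 - Suc d) (alt_poly r (Suc d)) \<and>
      ?M ^\<^sub>m (?ls ! d) *\<^sub>v u = 0\<^sub>v ?n"
      using ex_block_gen_graded[OF s d(2)] unfolding nth_heights[OF d(1)] by blast
  qed
  then obtain u where u: "\<forall>d\<in>{..<min r s}. u d \<in> carrier_vec ?n \<and>
      ?M ^\<^sub>m (?ls ! d - 1) *\<^sub>v u d = graded_vec 0 r s (r + s - 1 - Suc d) (alt_poly r (Suc d)) \<and>
      ?M ^\<^sub>m (?ls ! d) *\<^sub>v u d = 0\<^sub>v ?n"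
    by (rule bchoice[THEN exE])
  have "\<exists>Q\<in>carrier_mat ?n ?n. det Q \<noteq> 0 \<and> ?K * Q = Q * ?D"
  proof (rule jordan_strings_basis[OF K_carrier, of _ u])
    fix c assume zero: "\<And>x. x < ?n \<Longrightarrow> (\<Sum>d<length ?ls. c d * (?M ^\<^sub>m (?ls ! d - 1) *\<^sub>v u d) $ x) = 0"
    have "(\<Sum>d<min r s. c d * graded_vec 0 r s (r + s - 1 - Suc d) (alt_poly r (Suc d)) $ x) = 0"
      if "x < ?n" for x
      using zero[OF that] u unfolding ls by simp
    then show "\<forall>d<length ?ls. c d = 0"
      using alt_graded_independent[OF s] unfolding ls by blast
  qed (use u ls sum_list_heights in auto)
  then obtain Q where Q: "Q \<in> carrier_mat ?n ?n" "det Q \<noteq> 0" "?K * Q = Q * ?D" by blast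
  have D: "?D \<in> carrier_mat ?n ?n" using diag_J_carrier[of ?ls] by (simp only: sum_list_heights)
  obtain P where P: "P \<in> carrier_mat ?n ?n" "Q * P = 1\<^sub>m ?n" "P * Q = 1\<^sub>m ?n"
    using det_non_zero_imp_unit[OF Q(1,2), of undefined]
    by (auto simp: Units_def ring_mat_def)
  have PK: "P * ?K = ?D * P"
  proof -
    have "P * ?K = P * (?K * (Q * P))" using K_carrier[of r s] P by simp
    also have "\<dots> = P * (?K * Q * P)" using assoc_mult_mat[OF K_carrier Q(1) P(1)] by simp
    also have "\<dots> = P * (Q * (?D * P))" unfolding Q(3) using assoc_mult_mat[OF Q(1) D P(1)] by simp
    also have "\<dots> = (P * Q) * (?D * P)" using assoc_mult_mat[OF P(1) Q(1) mult_carrier_mat[OF D P(1)]] by simp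
    also have "\<dots> = ?D * P" unfolding P(3) by (rule left_mult_one_mat[OF mult_carrier_mat[OF D P(1)]])
    finally show ?thesis .
  qed
  \<comment> \<open>On both sides a group element acts by the same power of the matrix of
    \<open>g\<close>, given by its least exponent, so it suffices to intertwine powers.\<close>
  have PKk: "P * ?K ^\<^sub>m k = ?D ^\<^sub>m k * P" for k
  proof (induction k)
    case 0
    then show ?case using K_carrier[of r s] D P(1) by auto
  next
    case (Suc k)
    have "P * ?K ^\<^sub>m Suc k = P * ?K ^\<^sub>m k * ?K"
      using assoc_mult_mat[OF P(1) pow_carrier_mat[OF K_carrier] K_carrier, of k] by simp
    also have "\<dots> = ?D ^\<^sub>m k * (P * ?K)"
      unfolding Suc using assoc_mult_mat[OF pow_carrier_mat[OF D] P(1) K_carrier, of k] by simp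
    also have "\<dots> = ?D ^\<^sub>m Suc k * P"
      unfolding PK using assoc_mult_mat[OF pow_carrier_mat[OF D] D P(1), of k] by simp
    finally show ?case .
  qed
  have "invertible_mat P"
    using P Q(1) unfolding invertible_mat_def inverts_mat_def by (auto intro!: exI[of _ Q])
  then have "rep_iso G (V_tensor G g r s) (rep_dsum (map (V_rep G g) ?ls) :: 'g \<Rightarrow> 'a mat)"
    unfolding rep_iso_def rep_dsum_V_rep rep_tensor_def V_rep_def
      kron_mat_pow[OF jordan_block_carrier jordan_block_carrier]
    using P(1) PKk pow_carrier_mat[OF K_carrier] pow_carrier_mat[OF D] by blast
  moreover have "\<forall>l\<in>set ?ls. 0 < l"
  proof
    fix l assume "l \<in> set ?ls"
    moreover have "set ?ls = height TYPE('a) r s ` {1..min r s}"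
      by (simp add: heights_def atLeastLessThanSuc_atLeastAtMost del: upt_Suc)
    ultimately obtain d where "d \<in> {1..min r s}" "l = height TYPE('a) r s d" by blast
    then show "0 < l" using height_pos[of d r s, where 'a='a] by simp
  qed
  ultimately show ?thesis
    unfolding decomposes_into_def using ls sorted_heights by blast
qed

section \<open>Antidiagonals of J as coefficients of block generators\<close>

lemma y_coeffs_eq:
  fixes y :: "'a poly"
  assumes s: "s \<le> order G" and l: "l \<in> {1..min r s}" and first: "first_eq (heights TYPE('a) r s) l = l"
    and y: "block_gen r s l y"
  shows "y_coeffs G g N r s l (height TYPE('a) r s l) = (\<lambda>j. if j \<in> {1..l} then coeff y (l - j) else 0)"
proof -
  define h where "h = height TYPE('a) r s l"
  define d where "d = last_eq (heights TYPE('a) r s) l"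
  define Y where "Y c = (\<Sum>j\<in>{1..l}. monom (c j) (l - j))" for c :: "nat \<Rightarrow> 'a"
  have block: "h + l + d = r + s + 1" using height_block[OF l, where 'a='a] first by (simp add: h_def d_def)
  have d: "1 \<le> d" "d \<le> min r s" using height_last(1)[OF l, where 'a='a] by (simp_all add: d_def)
  have h: "1 \<le> h" using height_pos[OF l] by (simp add: h_def)
  have l': "1 \<le> l" "l \<le> min r s" and s0: "0 < s" using l by auto
  have cY: "coeff (Y c) i = (if i < l then c (l - i) else 0)" for c i
  proof -
    have "coeff (Y c) i = (\<Sum>j\<in>{1..l}. if j = l - i then (if i < l then c (l - i) else 0) else 0)"
      unfolding Y_def coeff_sum by (intro sum.cong) auto
    then show ?thesis using l' by auto
  qed
  have degY: "degree (Y c) \<le> l - 1" for c by (rule degree_le) (auto simp: cY)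
  have degY': "degree (Y c) + d + h \<le> r + s" for c using degY[of c] block l' by linarith
  \<comment> \<open>By \<open>height_block\<close>, the target index r + s + 1 - l - h in the
    definition of J is the last index of the run that starts at \<open>l\<close>.\<close>
  have eqs: "r + s + 1 - l - h = d" "l - 1 + (h - 1) = r + s - 1 - d" using block l' h by auto
  have gen: "(K r s - 1\<^sub>m (r * s)) ^\<^sub>m (h - 1) *\<^sub>v
        finsum_vec TYPE('a) (r * s) (\<lambda>j. c j \<cdot>\<^sub>v v_basis G g N r s (r - l + j) (s + 1 - j)) {1..l}
      = x_vec G g N r s (r + s + 1 - l - h) \<longleftrightarrow> block_gen r s l (Y c)" for c
    unfolding v_basis_sum_graded[OF s l'] Y_def[symmetric] graded_vec_pow[OF s degY] eqs
      x_vec_eq_graded[OF s d] graded_vec_alt_iff[OF s s0 d]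
    using degY'[of c] by (simp add: block_gen_def Let_def h_def d_def)
  let ?c = "\<lambda>j. if j \<in> {1..l} then coeff y (l - j) else 0"
  have uniq: "y' = y" if "block_gen r s l y'" for y' using ex1_block_gen[OF l] that y by blast
  have "degree y + d + h \<le> r + s"
    using y by (simp add: block_gen_def Let_def flip: h_def d_def)
  then have "degree y \<le> l - 1" using block l'(1) by linarith
  have Yc: "Y ?c = y"
  proof (rule poly_eqI)
    fix i show "coeff (Y ?c) i = coeff y i"
      using \<open>degree y \<le> l - 1\<close> l' by (auto simp: cY intro!: coeff_eq_0)
  qed
  show ?thesis
    unfolding y_coeffs_def V_tensor_generator h_def[symmetric]
  proof (rule the_equality, unfold gen)
    show "(\<forall>j. j \<notin> {1..l} \<longrightarrow> ?c j = 0) \<and> block_gen r s l (Y ?c)" using Yc y by simp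
    fix c assume c: "(\<forall>j. j \<notin> {1..l} \<longrightarrow> c j = 0) \<and> block_gen r s l (Y c)"
    then have "Y c = y" using uniq by blast
    then have "c j = coeff y (l - j)" if "j \<in> {1..l}" for j
      using cY[of c "l - j"] that by auto
    then show "c = ?c" using c by auto
  qed
qed

text \<open>Column \<open>j\<close> belongs to the exponent k - j. Copying the antidiagonal of
  \<open>k0\<close> column by column with the sign (-1)^(k-k0) shifts the exponents by k - k0, that
  is, multiplies the generator by (-X)^(k-k0); the zero entries in columns beyond \<open>k0\<close>
  are the low coefficients of this product.\<close>

lemma entry_J_mat:
  fixes y :: "'a poly"
  assumes s: "s \<le> order G" and k: "k \<in> {1..min r s}" and j: "j \<in> {1..k}" and y: "block_gen r s k y"
  defines "k0 \<equiv> first_eq (heights TYPE('a) r s) k"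
  shows "entry (J_mat G g N r s) (k + 1 - j) j = coeff (monom ((-1) ^ (k - k0)) (k - k0) * y) (k - j)"
proof -
  let ?ls = "heights TYPE('a) r s"
  have the: "(THE ls. decomposes_into G g (V_tensor G g r s :: 'g \<Rightarrow> 'a mat) (min r s) ls) = ?ls"
    by (rule the_equality, rule decomposes_into_heights[OF s], erule decomposes_into_unique,
        rule decomposes_into_heights[OF s])
  have kl: "k \<in> {1..length ?ls}" using k by (simp add: length_heights)
  note fl = first_last_eq[OF kl, folded k0_def]
  have jk: "1 \<le> j" "j \<le> k" and kb: "1 \<le> k" "k \<le> min r s" using j k by auto
  have nk: "\<not> min r s < k" using kb(2) by (simp only: not_less)
  have k0: "k0 \<in> {1..min r s}" "k0 \<le> k" using fl(1) kb by auto
  have hk0: "height TYPE('a) r s k0 = height TYPE('a) r s k"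
    using fl(3) part_heights[OF k0(1), of "TYPE('a)"] part_heights[OF k, of "TYPE('a)"] by simp
  have cong: "first_eq ?ls k0 = k0" "last_eq ?ls k0 = last_eq ?ls k"
    using first_last_eq_cong[OF fl(3)] by (simp_all add: k0_def)
  have y0: "block_gen r s k0 y" using y by (simp add: block_gen_def Let_def hk0 cong)
  note yc = y_coeffs_eq[OF s k0(1) cong(1) y0, of N]
  have idx: "k + 1 - j - 1 = k - j" "k - j < r" "j - 1 < s" "k - j + (j - 1) + 1 = k" "j - 1 + 1 = j"
    using jk kb by auto
  have "entry (J_mat G g N r s) (k + 1 - j) j =
      (if k = k0 then y_coeffs G g N r s k (part ?ls k) j
       else if j \<le> k0 then (-1) ^ (k - k0) * y_coeffs G g N r s k0 (part ?ls k0) j else (0 :: 'a))"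
    using kb(1) nk idx unfolding J_mat_def the by (simp add: Let_def k0_def)
  also have "\<dots> = (if j \<le> k0 then (-1) ^ (k - k0) * coeff y (k0 - j) else 0)"
    using jk yc part_heights[OF k0(1), of "TYPE('a)"] by auto
  also have "\<dots> = coeff (monom ((-1) ^ (k - k0)) (k - k0) * y) (k - j)"
    using jk k0(2) by (auto simp: coeff_monom_mult)
  finally show ?thesis .
qed

text \<open>The sums \<open>A\<^sub>i(z)\<close> and \<open>D\<^sub>i(z)\<close> both have this shape: they are coefficients of
  \<open>(1 + X)\<^bsup>\<mu>-1\<^esup>\<close> times the generating polynomial of an antidiagonal of \<open>J(r, s)\<close>.\<close>

lemma sum_entry_J_mat:
  fixes y :: "'a poly"
  assumes s: "s \<le> order G" and k: "k \<in> {1..min r s}" and y: "block_gen r s k y"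
  defines "i \<equiv> k - first_eq (heights TYPE('a) r s) k"
  shows "(\<Sum>j = 1..k. entry (J_mat G g N r s) (k + 1 - j) j * binom c (x + int j - int k))
    = icoeff ([:1, 1:] ^ c * (monom ((-1) ^ i) i * y)) x"
proof -
  let ?ls = "heights TYPE('a) r s"
  have "k \<in> {1..length ?ls}" using k by (simp add: length_heights)
  note fl = first_last_eq[OF this]
  have k0: "1 \<le> first_eq ?ls k" "first_eq ?ls k \<le> k" using fl(1) by auto
  have "degree y + last_eq ?ls k + height TYPE('a) r s k \<le> r + s"
    using y by (simp add: block_gen_def Let_def)
  then have "degree y < first_eq ?ls k"
    using height_block[OF k, where 'a='a] by linarith
  moreover have "degree (monom ((-1) ^ i) i * y) \<le> i + degree y"
    using degree_mult_le[of "monom ((-1) ^ i) i" y] degree_monom_le[of "(-1) ^ i :: 'a" i] by linarith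
  ultimately have "degree (monom ((-1) ^ i) i * y) < k" using k0 by (simp add: i_def)
  then show ?thesis
    unfolding sum_binom_eq_icoeff[symmetric, OF \<open>degree (monom ((-1) ^ i) i * y) < k\<close>]
    unfolding i_def by (intro sum.cong refl arg_cong2[where f = "(*)"] entry_J_mat[OF s k _ y])
qed

end

theorem theorem2:
  fixes G :: "('g, 'b) monoid_scheme" and g :: 'g
    and p a n R S k t z :: nat and N :: int and \<mu> :: "nat list"
    and A D :: "'a::field mat" and Ai Di :: "nat \<Rightarrow> nat \<Rightarrow> 'a" and f :: "nat \<Rightarrow> nat \<Rightarrow> 'a"
    and m k' :: nat and e :: int
  assumes p: "prime p" and char: "CHAR('a) = p"
    and G: "group G" "g \<in> carrier G" "generate G {g} = carrier G"
    and a: "a \<ge> 1" and q: "order G = p ^ a"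
    and n: "n \<ge> 1" "p ^ n \<le> p ^ a"
    and RS: "0 < R" "R < p ^ n" "0 < S" "S < p ^ n"
  defines "m \<equiv> min R S"
    and "e \<equiv> int R + int S - int (p ^ n)"
  assumes \<mu>: "decomposes_into G g (V_tensor G g R S :: 'g \<Rightarrow> 'a mat) m \<mu>"
    and k: "max e 0 + 1 \<le> int k" "k \<le> m"
  defines "k' \<equiv> first_eq \<mu> k + last_eq \<mu> k - k"
    and "A \<equiv> J_mat G g N R S"
    and "D \<equiv> J_mat G g N (p ^ n - R) (p ^ n - S)"
    and "Ai \<equiv> \<lambda>i z. \<Sum>j = 1..k. entry A (k + 1 - j) j *
           binom (part \<mu> k - 1) (int i * int (p ^ n) + int R - int k + int j - int z)"
    and "Di \<equiv> \<lambda>i z. \<Sum>j = 1..nat (int k - e). entry D (nat (int k - e) + 1 - j) j *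
           binom (part \<mu> k - 1) (int i * int (p ^ n) + int R + int S + int j - int k - int z)"
    and "f \<equiv> \<lambda>t z. (\<Sum>i = 0..t. (- 1) ^ i * Ai i z) + (- 1) ^ R * (\<Sum>i = 0..t. (- 1) ^ i * Di i z)"
  assumes z: "1 \<le> z" "z \<le> t * p ^ n + p ^ n - S + k'"
  shows "f t z = (- 1) ^ (z - 1)"
proof -
  define Q where "Q = p ^ n"
  have pow: "[:1, 1:] ^ Q = monom 1 Q + (1 :: 'a poly)"
    using linear_power_CHAR[of n, where 'a='a] p by (simp add: Q_def char)
  interpret cyclic_char_group G g a "TYPE('a)"
    by (rule cyclic_char_group.intro[OF G]) (simp_all only: char p q a)
  have RSQ: "R < Q" "S < Q" "0 < R" "0 < S" using RS by (simp_all add: Q_def)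
  have ord: "S \<le> order G" "Q - S \<le> order G" using RS n q by (simp_all add: Q_def)
  have \<mu>_eq: "\<mu> = heights TYPE('a) R S"
    using decomposes_into_unique[OF \<mu> decomposes_into_heights[OF ord(1)]] .
  \<comment> \<open>This is the index dual to \<open>k\<close>; the lower bound on \<open>k\<close>
    makes it positive.\<close>
  define l where "l = nat (int k - e)"
  have k_mem: "k \<in> {1..min R S}" using k by (auto simp: m_def)
  have e: "e = int R + int S - int Q" by (simp add: e_def Q_def)
  have l: "l + R + S = k + Q" "l \<ge> 1" using k(1) by (simp_all add: l_def e)
  note l_mem = height_le_dual(1)[OF pow RSQ(1,2) k_mem l]
  define h where "h = height TYPE('a) R S k"
  have h: "part \<mu> k = h" using part_heights[OF k_mem, of "TYPE('a)"] by (simp add: \<mu>_eq h_def)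
  have h1: "1 \<le> h" using height_pos[OF k_mem] by (simp add: h_def)
  define k1 where "k1 = last_eq \<mu> k"
  define i where "i = k - first_eq \<mu> k"
  have "k \<in> {1..length \<mu>}" using k_mem by (simp add: \<mu>_eq length_heights)
  note fl = first_last_eq[OF this]
  have i: "i \<le> k1" "k' = k1 - i" using fl(1,2) by (auto simp: i_def k'_def k1_def)
  \<comment> \<open>Duality shifts runs as a whole, so the distance to the first index is the same
    on both sides and one factor (-X)^i serves both sums.\<close>
  have il: "l - first_eq (heights TYPE('a) (Q - R) (Q - S)) l = i"
    using first_last_dual(1)[OF pow RSQ k_mem l] l by (simp add: i_def \<mu>_eq)
  obtain y w :: "'a poly" where y: "block_gen R S k y" and w: "block_gen (Q - R) (Q - S) l w"
    using ex1_block_gen[OF k_mem] ex1_block_gen[OF l_mem] by blast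
  obtain U V where UV: "pade R S k1 h U V" "poly U (-1) = 1" "[:1, 1:] ^ h * y = monom 1 R * U + V"
    "[:1, 1:] ^ h * w = smult (- ((-1) ^ R)) (monom 1 (Q - R) * V - U)"
    using block_gen_dual[OF pow RSQ k_mem l y w] unfolding h_def k1_def \<mu>_eq by blast
  define T :: "'a poly" where "T = [:1, 1:]"
  \<comment> \<open>The factor (-X)^i takes the value 1 at -1, so U(-1) = 1 is preserved. It raises
    the degree of \<open>U\<close> by i, which reduces the slack from \<open>k1\<close> to k1 - i =
    k'.\<close>
  define M :: "'a poly" where "M = monom ((-1) ^ i) i"
  have T: "T * (T ^ (h - 1) * v) = T ^ h * v" for v
    using h1 by (simp add: power_eq_if mult.assoc)
  have P: "T * (T ^ (h - 1) * (M * y)) = monom 1 R * (M * U) + M * V"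
    unfolding T using UV(3) by (simp add: T_def[symmetric] algebra_simps)
  have Q': "T * (T ^ (h - 1) * (M * w)) = smult (- ((-1) ^ R)) (monom 1 (Q - R) * (M * V) - M * U)"
    unfolding T mult.left_commute[of "T ^ h" M] UV(4)[folded T_def]
    by (simp only: mult_smult_right right_diff_distrib mult.left_commute)
  have M1: "poly (M * U) (-1) = 1"
    using UV(2) by (simp add: M_def poly_monom flip: power_mult_distrib)
  have "degree (M * U) \<le> i + degree U"
    using degree_mult_le[of M U] degree_monom_le[of "(-1) ^ i :: 'a" i] unfolding M_def by linarith
  then have deg: "degree (M * U) + k' \<le> S" using UV(1) i by (auto simp: pade_def)
  \<comment> \<open>As S < p^n, the subtraction of natural numbers in the bound on \<open>z\<close>
    is exact.\<close>
  have z': "z + S \<le> (t + 1) * Q + k'" using z(2) RSQ(2) by (simp add: Q_def)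
  have ik: "k - first_eq (heights TYPE('a) R S) k = i" by (simp add: i_def \<mu>_eq)
  have A: "Ai b z = icoeff (T ^ (h - 1) * (M * y)) (int b * int Q + int R - int z)" for b
  proof -
    have arg: "int b * int (p ^ n) + int R - int k + int j - int z
        = int b * int Q + int R - int z + int j - int k" for j
      by (simp add: Q_def)
    show ?thesis
      using sum_entry_J_mat[OF ord(1) k_mem y, of N "h - 1" "int b * int Q + int R - int z"]
      unfolding Ai_def A_def h T_def M_def arg ik .
  qed
  have D: "Di b z = icoeff (T ^ (h - 1) * (M * w)) (int b * int Q + int Q - int z)" for b
  proof -
    have "int R + int S - int k = int Q - int l" using l(1) by linarith
    then have arg: "int b * int Q + int R + int S + int j - int k - int z
        = int b * int Q + int Q - int z + int j - int l" for j
      by linarith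
    show ?thesis
      using sum_entry_J_mat[OF ord(2) l_mem w, of N "h - 1" "int b * int Q + int Q - int z"]
      unfolding Di_def D_def h T_def M_def l_def[symmetric] il Q_def[symmetric] arg .
  qed
  have "f t z = (\<Sum>i = 0..t. (-1) ^ i * (Ai i z + (-1) ^ R * Di i z))"
    by (simp add: f_def sum.distrib sum_distrib_left distrib_left mult.left_commute)
  also have "\<dots> = (-1) ^ (z - 1)"
    unfolding A D
    by (rule alternating_sum[OF P[unfolded T_def] Q'[unfolded T_def] M1 deg RSQ(1,2) z(1) z', folded T_def])
  finally show ?thesis .
qed

end
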